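(* Let $\varphi\colon R\to S$ be a homomorphism of commutative rings such that $2=0$ in $S$. Regard $\mathrm{Fr}_\varphi^*S\otimes_{S\otimes_R\mathrm{Fr}^*R/2}\mathrm{Fr}_\varphi^*S$ as an $S$-algebra via $$S\longrightarrow\mathrm{Fr}_\varphi^*S\otimes_{S\otimes_R\mathrm{Fr}^*R/2}\mathrm{Fr}_\varphi^*S,\quad s\longmapsto s\otimes 1.$$ Then the two maps $$\mathrm{Q}_\varphi\longrightarrow\mathrm{Fr}_\varphi^*S\otimes_{S\otimes_R\mathrm{Fr}^*R/2}\mathrm{Fr}_\varphi^*S,\quad s\otimes s'\otimes t\longmapsto t\otimes ss',$$ $$\mathrm{Fr}_\varphi^*S\otimes_{S\otimes_R\mathrm{Fr}^*R/2}\mathrm{Fr}_\varphi^*S\longrightarrow\mathrm{Q}_\varphi,\quad s\otimes s'\longmapsto s'\otimes 1\otimes s$$ are (well-defined and) inverse isomorphisms over and under $S$.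
   Context: Let $\Delta_\varphi\subseteq S\otimes_R S$ be the $R$-subalgebra spanned by the elements $s\otimes s$, $s\in S$; regard $S$ as a $\Delta_\varphi$-algebra via the restriction of the multiplication map $S\otimes_R S\to S$. Put $\mathrm{Q}_\varphi=(S\otimes_R S)\otimes_{\Delta_\varphi}S$, an $S$-algebra via $s\mapsto 1\otimes 1\otimes s$, augmented over $S$ by $s\otimes s'\otimes t\mapsto ss't$. $\mathrm{Fr}\colon R\to R/2$, $r\mapsto r^2$, is the Frobenius of $R$, and $\mathrm{Fr}^*R/2$ is $R/2$ regarded as an $R$-algebra via $\mathrm{Fr}$. The relative Frobenius is the ring map $\mathrm{Fr}_\varphi\colon S\otimes_R\mathrm{Fr}^*R/2\to S$, $s\otimes r\mapsto s^2\varphi(r)$, and $\mathrm{Fr}_\varphi^*S$ is $S$ regarded as an $(S\otimes_R\mathrm{Fr}^*R/2)$-algebra via $\mathrm{Fr}_\varphi$. The algebra $\mathrm{Fr}_\varphi^*S\otimes_{S\otimes_R\mathrm{Fr}^*R/2}\mathrm{Fr}_\varphi^*S$ is augmented over $S$ by multiplication. "Over and under $S$" means compatible with the augmentations to $S$ and with the structure maps from $S$. *)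

theory Defs
  imports "HOL-Algebra.Generated_Groups" "HOL-Algebra.QuotRing" "HOL-Library.Poly_Mapping"
begin

section \<open>Tensor products of commutative algebras\<close>

text \<open>
  The monoid ring \<open>\<int>[A \<times> C]\<close> on the multiplicative monoid of \<open>A \<times> C\<close>: additively it is the free
  abelian group on pairs, and the basis elements multiply by \<open>(a, c) (a', c') = (a a', c c')\<close>.
\<close>

definition pair_ring ::
  "('a, 'm) ring_scheme \<Rightarrow> ('c, 'n) ring_scheme \<Rightarrow> (('a \<times> 'c) \<Rightarrow>\<^sub>0 int) ring" where
  "pair_ring A C =
    \<lparr>carrier = {x. Poly_Mapping.keys x \<subseteq> carrier A \<times> carrier C},
     monoid.mult = (\<lambda>x y. frag_extend (\<lambda>p. frag_extend (\<lambda>q.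
        frag_of (fst p \<otimes>\<^bsub>A\<^esub> fst q, snd p \<otimes>\<^bsub>C\<^esub> snd q)) y) x),
     monoid.one = frag_of (\<one>\<^bsub>A\<^esub>, \<one>\<^bsub>C\<^esub>),
     ring.zero = 0,
     ring.add = (+)\<rparr>"

text \<open>
  \<open>A\<close> and \<open>C\<close> are \<open>B\<close>-algebras via \<open>f : B \<rightarrow> A\<close> and \<open>g : B \<rightarrow> C\<close>. The algebra \<open>A \<otimes>\<^sub>B C\<close> is the free
  abelian group on pairs modulo the subgroup generated by the bilinearity relations; this subgroup
  is an ideal of \<^const>\<open>pair_ring\<close>, so the multiplication descends.
\<close>

definition tensor_relations ::
  "('b, 'k) ring_scheme \<Rightarrow> ('a, 'm) ring_scheme \<Rightarrow> ('b \<Rightarrow> 'a) \<Rightarrow>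
   ('c, 'n) ring_scheme \<Rightarrow> ('b \<Rightarrow> 'c) \<Rightarrow> (('a \<times> 'c) \<Rightarrow>\<^sub>0 int) set" where
  "tensor_relations B A f C g =
     {frag_of (a \<oplus>\<^bsub>A\<^esub> a', c) - frag_of (a, c) - frag_of (a', c) | a a' c.
        a \<in> carrier A \<and> a' \<in> carrier A \<and> c \<in> carrier C} \<union>
     {frag_of (a, c \<oplus>\<^bsub>C\<^esub> c') - frag_of (a, c) - frag_of (a, c') | a c c'.
        a \<in> carrier A \<and> c \<in> carrier C \<and> c' \<in> carrier C} \<union>
     {frag_of (a \<otimes>\<^bsub>A\<^esub> f b, c) - frag_of (a, g b \<otimes>\<^bsub>C\<^esub> c) | a b c.
        a \<in> carrier A \<and> b \<in> carrier B \<and> c \<in> carrier C}"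

definition tensor_kernel ::
  "('b, 'k) ring_scheme \<Rightarrow> ('a, 'm) ring_scheme \<Rightarrow> ('b \<Rightarrow> 'a) \<Rightarrow>
   ('c, 'n) ring_scheme \<Rightarrow> ('b \<Rightarrow> 'c) \<Rightarrow> (('a \<times> 'c) \<Rightarrow>\<^sub>0 int) set" where
  "tensor_kernel B A f C g =
     generate (add_monoid (pair_ring A C)) (tensor_relations B A f C g)"

definition tensor_ring ::
  "('b, 'k) ring_scheme \<Rightarrow> ('a, 'm) ring_scheme \<Rightarrow> ('b \<Rightarrow> 'a) \<Rightarrow>
   ('c, 'n) ring_scheme \<Rightarrow> ('b \<Rightarrow> 'c) \<Rightarrow> (('a \<times> 'c) \<Rightarrow>\<^sub>0 int) set ring" where
  "tensor_ring B A f C g = pair_ring A C Quot tensor_kernel B A f C g"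

definition pure_tensor ::
  "('b, 'k) ring_scheme \<Rightarrow> ('a, 'm) ring_scheme \<Rightarrow> ('b \<Rightarrow> 'a) \<Rightarrow>
   ('c, 'n) ring_scheme \<Rightarrow> ('b \<Rightarrow> 'c) \<Rightarrow> 'a \<Rightarrow> 'c \<Rightarrow> (('a \<times> 'c) \<Rightarrow>\<^sub>0 int) set" where
  "pure_tensor B A f C g a c = tensor_kernel B A f C g +>\<^bsub>pair_ring A C\<^esub> frag_of (a, c)"

text \<open>
  The additive map out of a tensor product with \<open>a \<otimes> c \<mapsto> h a c\<close>. It is meaningful if \<open>h\<close> is
  biadditive and balanced over the base: exactly then the additive extension \<open>pair_eval\<close> is constant
  on the cosets \<open>u\<close>. Otherwise \<^const>\<open>the_elem\<close> returns an unspecified value.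
\<close>

definition pair_eval ::
  "('d, 'm) ring_scheme \<Rightarrow> ('a \<Rightarrow> 'c \<Rightarrow> 'd) \<Rightarrow> (('a \<times> 'c) \<Rightarrow>\<^sub>0 int) \<Rightarrow> 'd" where
  "pair_eval D h x =
     (\<Oplus>\<^bsub>D\<^esub>p\<in>Poly_Mapping.keys x. add_pow D (Poly_Mapping.lookup x p) (h (fst p) (snd p)))"

definition tensor_lift ::
  "('d, 'm) ring_scheme \<Rightarrow> ('a \<Rightarrow> 'c \<Rightarrow> 'd) \<Rightarrow> (('a \<times> 'c) \<Rightarrow>\<^sub>0 int) set \<Rightarrow> 'd" where
  "tensor_lift D h u = the_elem (pair_eval D h ` u)"


section \<open>The algebra \<open>Q\<^sub>\<phi>\<close>\<close>

type_synonym 's sq = "(('s \<times> 's) \<Rightarrow>\<^sub>0 int) set"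

definition SS_ring ::
  "('r, 'm) ring_scheme \<Rightarrow> ('s, 'n) ring_scheme \<Rightarrow> ('r \<Rightarrow> 's) \<Rightarrow> 's sq ring" where
  "SS_ring R S \<phi> = tensor_ring R S \<phi> S \<phi>"

definition SS_pure ::
  "('r, 'm) ring_scheme \<Rightarrow> ('s, 'n) ring_scheme \<Rightarrow> ('r \<Rightarrow> 's) \<Rightarrow> 's \<Rightarrow> 's \<Rightarrow> 's sq" where
  "SS_pure R S \<phi> = pure_tensor R S \<phi> S \<phi>"

definition SS_mult :: "('s, 'n) ring_scheme \<Rightarrow> 's sq \<Rightarrow> 's" where
  "SS_mult S = tensor_lift S (\<lambda>s s'. s \<otimes>\<^bsub>S\<^esub> s')"

text \<open>
  The \<open>R\<close>-linear span of the elements \<open>s \<otimes> s\<close>; it is a subalgebra because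
  \<open>(s \<otimes> s) (t \<otimes> t) = st \<otimes> st\<close>. The generators are written \<open>r (s \<otimes> s) = \<phi>(r) s \<otimes> s\<close>.
\<close>

definition Delta ::
  "('r, 'm) ring_scheme \<Rightarrow> ('s, 'n) ring_scheme \<Rightarrow> ('r \<Rightarrow> 's) \<Rightarrow> 's sq set" where
  "Delta R S \<phi> = generate (add_monoid (SS_ring R S \<phi>))
     {SS_pure R S \<phi> (\<phi> r \<otimes>\<^bsub>S\<^esub> s) s | r s. r \<in> carrier R \<and> s \<in> carrier S}"

definition Delta_ring ::
  "('r, 'm) ring_scheme \<Rightarrow> ('s, 'n) ring_scheme \<Rightarrow> ('r \<Rightarrow> 's) \<Rightarrow> 's sq ring" where
  "Delta_ring R S \<phi> = (SS_ring R S \<phi>)\<lparr>carrier := Delta R S \<phi>\<rparr>"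

definition Q_ring ::
  "('r, 'm) ring_scheme \<Rightarrow> ('s, 'n) ring_scheme \<Rightarrow> ('r \<Rightarrow> 's) \<Rightarrow> (('s sq \<times> 's) \<Rightarrow>\<^sub>0 int) set ring" where
  "Q_ring R S \<phi> = tensor_ring (Delta_ring R S \<phi>) (SS_ring R S \<phi>) (\<lambda>x. x) S (SS_mult S)"

definition Q_pure ::
  "('r, 'm) ring_scheme \<Rightarrow> ('s, 'n) ring_scheme \<Rightarrow> ('r \<Rightarrow> 's) \<Rightarrow> 's \<Rightarrow> 's \<Rightarrow> 's \<Rightarrow>
   (('s sq \<times> 's) \<Rightarrow>\<^sub>0 int) set" where
  "Q_pure R S \<phi> s s' t =
     pure_tensor (Delta_ring R S \<phi>) (SS_ring R S \<phi>) (\<lambda>x. x) S (SS_mult S) (SS_pure R S \<phi> s s') t"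

definition Q_unit ::
  "('r, 'm) ring_scheme \<Rightarrow> ('s, 'n) ring_scheme \<Rightarrow> ('r \<Rightarrow> 's) \<Rightarrow> 's \<Rightarrow> (('s sq \<times> 's) \<Rightarrow>\<^sub>0 int) set" where
  "Q_unit R S \<phi> s = Q_pure R S \<phi> \<one>\<^bsub>S\<^esub> \<one>\<^bsub>S\<^esub> s"

text \<open>A map on \<open>(S \<otimes>\<^sub>R S) \<otimes> S\<close> is lifted in two steps: for fixed \<open>t\<close> first over \<open>S \<otimes>\<^sub>R S\<close>.\<close>

definition Q_aug :: "('s, 'n) ring_scheme \<Rightarrow> (('s sq \<times> 's) \<Rightarrow>\<^sub>0 int) set \<Rightarrow> 's" where
  "Q_aug S = tensor_lift S (\<lambda>u t. tensor_lift S (\<lambda>s s'. s \<otimes>\<^bsub>S\<^esub> s' \<otimes>\<^bsub>S\<^esub> t) u)"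


section \<open>The relative Frobenius\<close>

definition ideal2 :: "('r, 'm) ring_scheme \<Rightarrow> 'r set" where
  "ideal2 R = PIdl\<^bsub>R\<^esub> (\<one>\<^bsub>R\<^esub> \<oplus>\<^bsub>R\<^esub> \<one>\<^bsub>R\<^esub>)"

definition mod2_ring :: "('r, 'm) ring_scheme \<Rightarrow> 'r set ring" where
  "mod2_ring R = R Quot ideal2 R"

definition Frob :: "('r, 'm) ring_scheme \<Rightarrow> 'r \<Rightarrow> 'r set" where
  "Frob R r = ideal2 R +>\<^bsub>R\<^esub> (r \<otimes>\<^bsub>R\<^esub> r)"

text \<open>The map \<open>R/2 \<rightarrow> S\<close> induced by \<open>\<phi>\<close>; the image is a singleton because \<open>2 = 0\<close> in \<open>S\<close>.\<close>

definition mod2_map :: "('r \<Rightarrow> 's) \<Rightarrow> 'r set \<Rightarrow> 's" where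
  "mod2_map \<phi> u = the_elem (\<phi> ` u)"

definition Frob_base ::
  "('r, 'm) ring_scheme \<Rightarrow> ('s, 'n) ring_scheme \<Rightarrow> ('r \<Rightarrow> 's) \<Rightarrow>
   (('s \<times> 'r set) \<Rightarrow>\<^sub>0 int) set ring" where
  "Frob_base R S \<phi> = tensor_ring R S \<phi> (mod2_ring R) (Frob R)"

text \<open>\<open>s \<otimes> r \<mapsto> s\<^sup>2 \<phi>(r)\<close>; squaring is additive on \<open>S\<close> because \<open>2 = 0\<close> there.\<close>

definition rel_Frob ::
  "('s, 'n) ring_scheme \<Rightarrow> ('r \<Rightarrow> 's) \<Rightarrow> (('s \<times> 'r set) \<Rightarrow>\<^sub>0 int) set \<Rightarrow> 's" where
  "rel_Frob S \<phi> = tensor_lift S (\<lambda>s u. s \<otimes>\<^bsub>S\<^esub> s \<otimes>\<^bsub>S\<^esub> mod2_map \<phi> u)"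

definition F_ring ::
  "('r, 'm) ring_scheme \<Rightarrow> ('s, 'n) ring_scheme \<Rightarrow> ('r \<Rightarrow> 's) \<Rightarrow> 's sq ring" where
  "F_ring R S \<phi> = tensor_ring (Frob_base R S \<phi>) S (rel_Frob S \<phi>) S (rel_Frob S \<phi>)"

definition F_pure ::
  "('r, 'm) ring_scheme \<Rightarrow> ('s, 'n) ring_scheme \<Rightarrow> ('r \<Rightarrow> 's) \<Rightarrow> 's \<Rightarrow> 's \<Rightarrow> 's sq" where
  "F_pure R S \<phi> = pure_tensor (Frob_base R S \<phi>) S (rel_Frob S \<phi>) S (rel_Frob S \<phi>)"

definition F_unit ::
  "('r, 'm) ring_scheme \<Rightarrow> ('s, 'n) ring_scheme \<Rightarrow> ('r \<Rightarrow> 's) \<Rightarrow> 's \<Rightarrow> 's sq" where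
  "F_unit R S \<phi> s = F_pure R S \<phi> s \<one>\<^bsub>S\<^esub>"

definition F_aug :: "('s, 'n) ring_scheme \<Rightarrow> 's sq \<Rightarrow> 's" where
  "F_aug S = tensor_lift S (\<lambda>s s'. s \<otimes>\<^bsub>S\<^esub> s')"


section \<open>The two comparison maps\<close>

text \<open>\<open>s \<otimes> s' \<otimes> t \<mapsto> t \<otimes> s s'\<close>, again lifted in two steps.\<close>

definition Q_to_F ::
  "('r, 'm) ring_scheme \<Rightarrow> ('s, 'n) ring_scheme \<Rightarrow> ('r \<Rightarrow> 's) \<Rightarrow>
   (('s sq \<times> 's) \<Rightarrow>\<^sub>0 int) set \<Rightarrow> 's sq" where
  "Q_to_F R S \<phi> = tensor_lift (F_ring R S \<phi>)
     (\<lambda>u t. tensor_lift (F_ring R S \<phi>) (\<lambda>s s'. F_pure R S \<phi> t (s \<otimes>\<^bsub>S\<^esub> s')) u)"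

definition F_to_Q ::
  "('r, 'm) ring_scheme \<Rightarrow> ('s, 'n) ring_scheme \<Rightarrow> ('r \<Rightarrow> 's) \<Rightarrow>
   's sq \<Rightarrow> (('s sq \<times> 's) \<Rightarrow>\<^sub>0 int) set" where
  "F_to_Q R S \<phi> = tensor_lift (Q_ring R S \<phi>) (\<lambda>s s'. Q_pure R S \<phi> s' \<one>\<^bsub>S\<^esub> s)"

end

(*
  Every u in S (x)_R S becomes equal to mu(u) (x) 1 in Q, where mu is the multiplication: the element
  1 (x) s + s (x) 1 lies in Delta, being the difference of the diagonal elements at s + 1, s and 1,
  and mu sends it to 2s = 0. Hence Q is generated by the elements s' (x) 1 (x) s. Moreover mu(Delta)
  and the image of the relative Frobenius are the same subring of S, additively spanned by the
  elements phi(r) s^2, so the balancing relations of the two tensor products match.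
*)

theory Submission
  imports Defs
begin

section \<open>The monoid ring on pairs\<close>

text \<open>An element \<open>d\<close> of \<open>Delta\<close> acts on \<open>S \<otimes> S\<close>
  as itself but on \<open>S\<close> as \<open>\<mu> d\<close>, whereas an element of
  \<open>Frob_base\<close> acts on both factors of \<open>F_ring\<close> by the same element of
  \<open>S\<close>. Only after the factor \<open>S \<otimes> S\<close> has been collapsed along
  \<open>\<mu>\<close> do the two kinds of relations become comparable, and then the base matters
  only through its image in \<open>S\<close>. The obstacle is well-definedness:
  \<open>tensor_lift\<close> is \<open>the_elem\<close> of the image of a coset, so no formula for a
  map can be used before biadditivity and balancing are known. The two directions differ here.
  \<open>Q_to_F\<close> collapses \<open>S \<otimes> S\<close> in its very definition, so its
  balancing uses only that \<open>\<mu>\<close> maps \<open>Delta\<close> into the image of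
  \<open>rel_Frob\<close>. \<open>F_to_Q\<close> uses the opposite inclusion together with the
  collapse inside \<open>Q_ring\<close>. The collapse must therefore be proved before
  \<open>F_to_Q\<close> is known to exist, and it returns when \<open>F_to_Q\<close> is composed
  with \<open>Q_to_F\<close>.\<close>

lemma frag_extend_fun_diff:
  "frag_extend (\<lambda>p. f p - g p) x = frag_extend f x - frag_extend g x"
  using subset_UNIV by (induction x rule: frag_induction) (auto simp: frag_extend_diff)

locale cring_pair = A: cring A + C: cring C
  for A :: "('a, 'm) ring_scheme" and C :: "('c, 'n) ring_scheme"
begin

abbreviation P where "P \<equiv> pair_ring A C"

lemma pair_ring_simps:
  "carrier P = {x. Poly_Mapping.keys x \<subseteq> carrier A \<times> carrier C}"
  "\<zero>\<^bsub>P\<^esub> = 0"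
  "\<one>\<^bsub>P\<^esub> = frag_of (\<one>\<^bsub>A\<^esub>, \<one>\<^bsub>C\<^esub>)"
  "x \<oplus>\<^bsub>P\<^esub> y = x + y"
  by (simp_all add: pair_ring_def)

lemma pair_mult_frag_of:
  "frag_of p \<otimes>\<^bsub>P\<^esub> frag_of q = frag_of (fst p \<otimes>\<^bsub>A\<^esub> fst q, snd p \<otimes>\<^bsub>C\<^esub> snd q)"
  by (simp add: pair_ring_def)

lemma pair_mult_diff_left: "(x - y) \<otimes>\<^bsub>P\<^esub> z = x \<otimes>\<^bsub>P\<^esub> z - y \<otimes>\<^bsub>P\<^esub> z"
  by (simp add: pair_ring_def frag_extend_diff)

text \<open>The product is a nested \<open>frag_extend\<close>. The left factor is the argument of
  the outer one, but the right factor sits inside the function being extended, so additivity there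
  needs \<open>frag_extend_fun_diff\<close>.\<close>

lemma pair_mult_diff_right: "z \<otimes>\<^bsub>P\<^esub> (x - y) = z \<otimes>\<^bsub>P\<^esub> x - z \<otimes>\<^bsub>P\<^esub> y"
  by (simp add: pair_ring_def frag_extend_diff frag_extend_fun_diff)

text \<open>Zero, negatives and sums are all recovered from the two difference laws, starting with
  \<open>0 = z - z\<close>. The difference laws come first because \<open>frag_induction\<close>
  builds elements by subtraction.\<close>

lemma pair_mult_zero: "0 \<otimes>\<^bsub>P\<^esub> z = 0" "z \<otimes>\<^bsub>P\<^esub> 0 = 0"
  using pair_mult_diff_left[of z z z] pair_mult_diff_right[of z z z]
    pair_mult_diff_left[of 0 0 z] pair_mult_diff_right[of z 0 0] by simp_all

lemma pair_mult_minus: "(- x) \<otimes>\<^bsub>P\<^esub> z = - (x \<otimes>\<^bsub>P\<^esub> z)" "z \<otimes>\<^bsub>P\<^esub> (- x) = - (z \<otimes>\<^bsub>P\<^esub> x)"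
  using pair_mult_diff_left[of 0 x z] pair_mult_diff_right[of z 0 x]
  by (simp_all add: pair_mult_zero)

lemma pair_mult_add:
  "(x + y) \<otimes>\<^bsub>P\<^esub> z = x \<otimes>\<^bsub>P\<^esub> z + y \<otimes>\<^bsub>P\<^esub> z"
  "z \<otimes>\<^bsub>P\<^esub> (x + y) = z \<otimes>\<^bsub>P\<^esub> x + z \<otimes>\<^bsub>P\<^esub> y"
  using pair_mult_diff_left[of x "- y" z] pair_mult_diff_right[of z x "- y"]
  by (simp_all add: pair_mult_minus)

text \<open>Subtraction as the only step absorbs negative coefficients, so basis elements occur with
  sign plus only.\<close>

lemma pair_induct [consumes 1, case_names zero frag_of diff]:
  assumes "x \<in> carrier P" and "Q 0"
    and "\<And>a c. a \<in> carrier A \<Longrightarrow> c \<in> carrier C \<Longrightarrow> Q (frag_of (a, c))"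
    and "\<And>x y. Q x \<Longrightarrow> Q y \<Longrightarrow> Q (x - y)"
  shows "Q x"
  using assms(1)[unfolded pair_ring_simps mem_Collect_eq]
  by (induction x rule: frag_induction) (use assms in auto)

lemma frag_of_closed: "a \<in> carrier A \<Longrightarrow> c \<in> carrier C \<Longrightarrow> frag_of (a, c) \<in> carrier P"
  by (simp add: pair_ring_simps)

lemma pair_diff_closed: "x \<in> carrier P \<Longrightarrow> y \<in> carrier P \<Longrightarrow> x - y \<in> carrier P"
  using Poly_Mapping.keys_diff[of x y] by (auto simp: pair_ring_simps)

lemma pair_minus_closed: "x \<in> carrier P \<Longrightarrow> - x \<in> carrier P"
  by (simp add: pair_ring_simps)

lemma pair_add_closed: "x \<in> carrier P \<Longrightarrow> y \<in> carrier P \<Longrightarrow> x + y \<in> carrier P"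
  using Poly_Mapping.keys_add[of x y] by (auto simp: pair_ring_simps)

lemma pair_mult_closed:
  assumes "x \<in> carrier P" "y \<in> carrier P"
  shows "x \<otimes>\<^bsub>P\<^esub> y \<in> carrier P"
  using assms(1)
proof (induction x rule: pair_induct)
  case (frag_of a c)
  show ?case using assms(2)
  proof (induction y rule: pair_induct)
    case (frag_of a' c')
    then show ?case
      using \<open>a \<in> carrier A\<close> \<open>c \<in> carrier C\<close>
      by (simp add: pair_mult_frag_of frag_of_closed)
  qed (auto simp: pair_mult_zero pair_mult_diff_right intro: pair_diff_closed, simp add: pair_ring_simps)
qed (auto simp: pair_mult_zero pair_mult_diff_left intro: pair_diff_closed, simp add: pair_ring_simps)

lemma pair_mult_comm:
  assumes "x \<in> carrier P" "y \<in> carrier P"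
  shows "x \<otimes>\<^bsub>P\<^esub> y = y \<otimes>\<^bsub>P\<^esub> x"
  using assms(1)
proof (induction x rule: pair_induct)
  case (frag_of a c)
  show ?case using assms(2)
    by (induction y rule: pair_induct)
      (use frag_of in \<open>auto simp: pair_mult_zero pair_mult_diff_left pair_mult_diff_right
         pair_mult_frag_of A.m_comm C.m_comm\<close>)
qed (auto simp: pair_mult_zero pair_mult_diff_left pair_mult_diff_right)

lemma pair_mult_assoc:
  assumes "x \<in> carrier P" "y \<in> carrier P" "z \<in> carrier P"
  shows "x \<otimes>\<^bsub>P\<^esub> y \<otimes>\<^bsub>P\<^esub> z = x \<otimes>\<^bsub>P\<^esub> (y \<otimes>\<^bsub>P\<^esub> z)"
  using assms(1)
proof (induction x rule: pair_induct)
  case x: (frag_of a c)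
  show ?case using assms(2)
  proof (induction y rule: pair_induct)
    case y: (frag_of a' c')
    show ?case using assms(3)
      by (induction z rule: pair_induct)
        (use x y in \<open>auto simp: pair_mult_zero pair_mult_diff_right
           pair_mult_frag_of A.m_assoc C.m_assoc\<close>)
  qed (auto simp: pair_mult_zero pair_mult_diff_left pair_mult_diff_right)
qed (auto simp: pair_mult_zero pair_mult_diff_left)

lemma pair_mult_one:
  assumes "x \<in> carrier P"
  shows "\<one>\<^bsub>P\<^esub> \<otimes>\<^bsub>P\<^esub> x = x"
  using assms
  by (induction x rule: pair_induct)
    (auto simp: pair_mult_zero pair_mult_diff_right pair_ring_simps(3) pair_mult_frag_of)

lemma pair_ring_cring: "cring P"
proof (rule cringI)
  show "abelian_group P"
  proof (rule abelian_groupI)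
    show "\<exists>y\<in>carrier P. y \<oplus>\<^bsub>P\<^esub> x = \<zero>\<^bsub>P\<^esub>" if "x \<in> carrier P" for x
      using that by (intro bexI[of _ "- x"]) (auto simp: pair_ring_simps)
  qed (auto simp: pair_ring_simps(2,4) pair_add_closed add.assoc add.commute,
       simp add: pair_ring_simps)
  have "\<one>\<^bsub>P\<^esub> \<in> carrier P"
    by (simp add: pair_ring_simps(3) frag_of_closed)
  then show "comm_monoid P"
    by (intro comm_monoidI pair_mult_closed pair_mult_assoc pair_mult_one pair_mult_comm)
qed (simp add: pair_ring_simps(4) pair_mult_add)

end

sublocale cring_pair \<subseteq> P: cring P
  by (rule pair_ring_cring)

lemma (in cring_pair) pair_a_inv: "x \<in> carrier P \<Longrightarrow> \<ominus>\<^bsub>P\<^esub> x = - x"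
  by (rule P.minus_equality) (auto simp: pair_ring_simps)

section \<open>Tensor products\<close>

locale tensor = cring_pair A C
  for A :: "('a, 'm) ring_scheme" and C :: "('c, 'n) ring_scheme" +
  fixes B :: "('b, 'k) ring_scheme" and f :: "'b \<Rightarrow> 'a" and g :: "'b \<Rightarrow> 'c"
  assumes f_closed: "b \<in> carrier B \<Longrightarrow> f b \<in> carrier A"
    and g_closed: "b \<in> carrier B \<Longrightarrow> g b \<in> carrier C"
begin

abbreviation K where "K \<equiv> tensor_kernel B A f C g"
abbreviation T where "T \<equiv> tensor_ring B A f C g"
abbreviation pt where "pt \<equiv> pure_tensor B A f C g"

lemma tensor_relations_cases [consumes 1, case_names left right balanced]:
  assumes "x \<in> tensor_relations B A f C g"
  obtains (left) a a' c where "a \<in> carrier A" "a' \<in> carrier A" "c \<in> carrier C"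
      "x = frag_of (a \<oplus>\<^bsub>A\<^esub> a', c) - frag_of (a, c) - frag_of (a', c)"
    | (right) a c c' where "a \<in> carrier A" "c \<in> carrier C" "c' \<in> carrier C"
      "x = frag_of (a, c \<oplus>\<^bsub>C\<^esub> c') - frag_of (a, c) - frag_of (a, c')"
    | (balanced) a b c where "a \<in> carrier A" "b \<in> carrier B" "c \<in> carrier C"
      "x = frag_of (a \<otimes>\<^bsub>A\<^esub> f b, c) - frag_of (a, g b \<otimes>\<^bsub>C\<^esub> c)"
  using assms unfolding tensor_relations_def
  by (elim UnE CollectE exE conjE) (erule (3) left right balanced)+

lemma tensor_relations_intros:
  "a \<in> carrier A \<Longrightarrow> a' \<in> carrier A \<Longrightarrow> c \<in> carrier C \<Longrightarrow>
    frag_of (a \<oplus>\<^bsub>A\<^esub> a', c) - frag_of (a, c) - frag_of (a', c) \<in> tensor_relations B A f C g"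
  "a \<in> carrier A \<Longrightarrow> c \<in> carrier C \<Longrightarrow> c' \<in> carrier C \<Longrightarrow>
    frag_of (a, c \<oplus>\<^bsub>C\<^esub> c') - frag_of (a, c) - frag_of (a, c') \<in> tensor_relations B A f C g"
  "a \<in> carrier A \<Longrightarrow> b \<in> carrier B \<Longrightarrow> c \<in> carrier C \<Longrightarrow>
    frag_of (a \<otimes>\<^bsub>A\<^esub> f b, c) - frag_of (a, g b \<otimes>\<^bsub>C\<^esub> c) \<in> tensor_relations B A f C g"
  unfolding tensor_relations_def by blast+

lemma tensor_relations_subset: "tensor_relations B A f C g \<subseteq> carrier P"
proof
  fix x assume "x \<in> tensor_relations B A f C g"
  then show "x \<in> carrier P"
    by (cases x rule: tensor_relations_cases)
      (auto intro!: pair_diff_closed frag_of_closed f_closed g_closed)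
qed

lemma kernel_subgroup: "subgroup K (add_monoid P)"
  unfolding tensor_kernel_def
  by (rule P.add.generate_is_subgroup) (simp add: tensor_relations_subset)

lemma kernel_subset: "K \<subseteq> carrier P"
  using subgroup.subset[OF kernel_subgroup] by simp

lemma kernel_closed:
  "0 \<in> K" "x \<in> K \<Longrightarrow> y \<in> K \<Longrightarrow> x + y \<in> K" "x \<in> K \<Longrightarrow> - x \<in> K" "x \<in> K \<Longrightarrow> y \<in> K \<Longrightarrow> x - y \<in> K"
proof -
  show add: "x + y \<in> K" if "x \<in> K" "y \<in> K" for x y
    using subgroup.m_closed[OF kernel_subgroup that] by (simp add: pair_ring_simps)
  show minus: "- x \<in> K" if "x \<in> K" for x
    using subgroup.m_inv_closed[OF kernel_subgroup that] pair_a_inv kernel_subset that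
    by (auto simp: a_inv_def)
  show "0 \<in> K"
    using subgroup.one_closed[OF kernel_subgroup] by (simp add: pair_ring_simps)
  show "x - y \<in> K" if "x \<in> K" "y \<in> K" for x y
    using add[OF that(1) minus[OF that(2)]] by simp
qed

lemma relations_kernel: "x \<in> tensor_relations B A f C g \<Longrightarrow> x \<in> K"
  unfolding tensor_kernel_def by (rule generate.incl)

text \<open>Translates induction over \<open>generate\<close> from the notation of the additive
  monoid into \<open>0\<close>, \<open>-\<close> and \<open>+\<close> of
  \<open>Poly_Mapping\<close>, the form in which \<open>pair_mult_minus\<close>,
  \<open>pair_mult_add\<close> and \<open>pair_eval_add\<close> apply.\<close>

lemma kernel_induct [consumes 1, case_names zero relation minus add]:
  assumes "x \<in> K" and "Q 0"
    and "\<And>x. x \<in> tensor_relations B A f C g \<Longrightarrow> Q x"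
    and "\<And>x. x \<in> K \<Longrightarrow> Q x \<Longrightarrow> Q (- x)"
    and "\<And>x y. x \<in> K \<Longrightarrow> y \<in> K \<Longrightarrow> Q x \<Longrightarrow> Q y \<Longrightarrow> Q (x + y)"
  shows "Q x"
proof -
  \<comment> \<open>Membership in \<open>K\<close> is carried along, since the sum and negation
    cases offer it as a hypothesis. The inverse of a generator is obtained from the relation case
    followed by the negation case.\<close>
  have "x \<in> generate (add_monoid P) (tensor_relations B A f C g) \<Longrightarrow> x \<in> K \<and> Q x"
  proof (induction rule: generate.induct)
    case one
    have "\<one>\<^bsub>add_monoid P\<^esub> = 0" by (simp add: pair_ring_simps(2))
    then show ?case using assms(2) kernel_closed(1) by metis
  next
    case (incl h)
    then show ?case using assms(3) relations_kernel by blast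
  next
    case (inv h)
    then have "inv\<^bsub>add_monoid P\<^esub> h = - h"
      using pair_a_inv[of h] tensor_relations_subset by (auto simp: a_inv_def)
    with inv show ?case
      using assms(3,4) kernel_closed(3) relations_kernel by metis
  next
    case (eng x y)
    then show ?case using assms(5) kernel_closed(2) by (simp add: pair_ring_simps(4))
  qed
  with assms(1) show ?thesis by (simp add: tensor_kernel_def)
qed

text \<open>A basis element times a relation is a relation of the same kind, with entries multiplied
  by \<open>a\<close> and \<open>c\<close>. In the balanced case commutativity of \<open>C\<close>
  moves \<open>g b\<close> in front of \<open>c\<close>.\<close>

lemma relations_mult_kernel:
  assumes "x \<in> tensor_relations B A f C g" "a \<in> carrier A" "c \<in> carrier C"
  shows "frag_of (a, c) \<otimes>\<^bsub>P\<^esub> x \<in> K"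
  using assms(1)
proof (cases x rule: tensor_relations_cases)
  case (left a1 a2 c1)
  then show ?thesis
    using relations_kernel[OF tensor_relations_intros(1)[of "a \<otimes>\<^bsub>A\<^esub> a1" "a \<otimes>\<^bsub>A\<^esub> a2" "c \<otimes>\<^bsub>C\<^esub> c1"]] assms
    by (simp add: pair_mult_diff_right pair_mult_frag_of A.r_distr)
next
  case (right a1 c1 c2)
  then show ?thesis
    using relations_kernel[OF tensor_relations_intros(2)[of "a \<otimes>\<^bsub>A\<^esub> a1" "c \<otimes>\<^bsub>C\<^esub> c1" "c \<otimes>\<^bsub>C\<^esub> c2"]] assms
    by (simp add: pair_mult_diff_right pair_mult_frag_of C.r_distr)
next
  case (balanced a1 b c1)
  then show ?thesis
    using relations_kernel[OF tensor_relations_intros(3)[of "a \<otimes>\<^bsub>A\<^esub> a1" b "c \<otimes>\<^bsub>C\<^esub> c1"]] assms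
    by (simp add: pair_mult_diff_right pair_mult_frag_of A.m_assoc C.m_lcomm f_closed g_closed)
qed

lemma kernel_mult:
  assumes "x \<in> K" "y \<in> carrier P"
  shows "y \<otimes>\<^bsub>P\<^esub> x \<in> K"
  using assms(2)
proof (induction y rule: pair_induct)
  case (frag_of a c)
  show ?case using assms(1)
    by (induction x rule: kernel_induct)
      (use frag_of in \<open>simp_all add: pair_mult_zero pair_mult_minus pair_mult_add
         kernel_closed relations_mult_kernel\<close>)
qed (simp_all add: pair_mult_zero pair_mult_diff_left kernel_closed)

lemma kernel_ideal: "ideal K P"
proof (rule idealI[OF P.ring_axioms kernel_subgroup])
  fix x y assume xy: "x \<in> K" "y \<in> carrier P"
  then show "y \<otimes>\<^bsub>P\<^esub> x \<in> K" by (rule kernel_mult)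
  moreover have "x \<otimes>\<^bsub>P\<^esub> y = y \<otimes>\<^bsub>P\<^esub> x"
    using xy kernel_subset by (intro pair_mult_comm) auto
  ultimately show "x \<otimes>\<^bsub>P\<^esub> y \<in> K" by (rule ssubst[rotated])
qed

lemma tensor_ring_cring: "cring T"
  unfolding tensor_ring_def
  by (rule ideal.quotient_is_cring[OF kernel_ideal P.is_cring])

end

sublocale tensor \<subseteq> K: ideal K P
  by (rule kernel_ideal)

sublocale tensor \<subseteq> T: cring T
  by (rule tensor_ring_cring)

context tensor
begin

lemma coset_hom: "(+>\<^bsub>P\<^esub>) K \<in> ring_hom P T"
  unfolding tensor_ring_def by (rule K.rcos_ring_hom)

lemma carrier_tensor_ring: "carrier T = (+>\<^bsub>P\<^esub>) K ` carrier P"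
  by (auto simp: tensor_ring_def FactRing_def A_RCOSETS_def RCOSETS_def a_r_coset_def)

lemma coset_eqI:
  assumes "x - y \<in> K" "x \<in> carrier P" "y \<in> carrier P"
  shows "K +>\<^bsub>P\<^esub> x = K +>\<^bsub>P\<^esub> y"
proof -
  have "x \<in> K +>\<^bsub>P\<^esub> y"
    unfolding a_r_coset_def' by (rule UN_I[OF assms(1)]) (simp add: pair_ring_simps(4))
  from P.a_repr_independence[OF this assms(3) kernel_subgroup] show ?thesis by (rule sym)
qed

lemma pure_tensor_closed: "a \<in> carrier A \<Longrightarrow> c \<in> carrier C \<Longrightarrow> pt a c \<in> carrier T"
  by (auto simp: pure_tensor_def carrier_tensor_ring intro: frag_of_closed)

lemma coset_add:
  "x \<in> carrier P \<Longrightarrow> y \<in> carrier P \<Longrightarrow> K +>\<^bsub>P\<^esub> (x + y) = (K +>\<^bsub>P\<^esub> x) \<oplus>\<^bsub>T\<^esub> (K +>\<^bsub>P\<^esub> y)"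
  using ring_hom_add[OF coset_hom] by (simp add: pair_ring_simps(4))

lemma pure_tensor_add_left:
  assumes "a \<in> carrier A" "a' \<in> carrier A" "c \<in> carrier C"
  shows "pt (a \<oplus>\<^bsub>A\<^esub> a') c = pt a c \<oplus>\<^bsub>T\<^esub> pt a' c"
proof -
  have "K +>\<^bsub>P\<^esub> frag_of (a \<oplus>\<^bsub>A\<^esub> a', c) = K +>\<^bsub>P\<^esub> (frag_of (a, c) + frag_of (a', c))"
    using assms relations_kernel[OF tensor_relations_intros(1)[OF assms]]
    by (intro coset_eqI pair_add_closed frag_of_closed) (simp_all add: diff_diff_eq)
  with assms show ?thesis
    by (simp add: pure_tensor_def coset_add frag_of_closed)
qed

lemma pure_tensor_add_right:
  assumes "a \<in> carrier A" "c \<in> carrier C" "c' \<in> carrier C"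
  shows "pt a (c \<oplus>\<^bsub>C\<^esub> c') = pt a c \<oplus>\<^bsub>T\<^esub> pt a c'"
proof -
  have "K +>\<^bsub>P\<^esub> frag_of (a, c \<oplus>\<^bsub>C\<^esub> c') = K +>\<^bsub>P\<^esub> (frag_of (a, c) + frag_of (a, c'))"
    using assms relations_kernel[OF tensor_relations_intros(2)[OF assms]]
    by (intro coset_eqI pair_add_closed frag_of_closed) (simp_all add: diff_diff_eq)
  with assms show ?thesis
    by (simp add: pure_tensor_def coset_add frag_of_closed)
qed

lemma pure_tensor_balanced:
  assumes "a \<in> carrier A" "b \<in> carrier B" "c \<in> carrier C"
  shows "pt (a \<otimes>\<^bsub>A\<^esub> f b) c = pt a (g b \<otimes>\<^bsub>C\<^esub> c)"
  unfolding pure_tensor_def using assms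
    relations_kernel[OF tensor_relations_intros(3)[OF assms]]
  by (intro coset_eqI frag_of_closed) (simp_all add: f_closed g_closed)

lemma pure_tensor_mult:
  assumes "a \<in> carrier A" "a' \<in> carrier A" "c \<in> carrier C" "c' \<in> carrier C"
  shows "pt a c \<otimes>\<^bsub>T\<^esub> pt a' c' = pt (a \<otimes>\<^bsub>A\<^esub> a') (c \<otimes>\<^bsub>C\<^esub> c')"
  using assms ring_hom_mult[OF coset_hom, of "frag_of (a, c)" "frag_of (a', c')"]
  by (simp add: pure_tensor_def frag_of_closed pair_mult_frag_of)

lemma pure_tensor_one: "pt \<one>\<^bsub>A\<^esub> \<one>\<^bsub>C\<^esub> = \<one>\<^bsub>T\<^esub>"
  using ring_hom_one[OF coset_hom] by (simp add: pure_tensor_def pair_ring_simps(3))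

text \<open>By \<open>0 + 0 = 0\<close> and additivity, each of these pure tensors equals its own
  double, hence vanishes.\<close>

lemma pure_tensor_zero:
  assumes "a \<in> carrier A" "c \<in> carrier C"
  shows "pt \<zero>\<^bsub>A\<^esub> c = \<zero>\<^bsub>T\<^esub>" "pt a \<zero>\<^bsub>C\<^esub> = \<zero>\<^bsub>T\<^esub>"
  using pure_tensor_add_left[of "\<zero>\<^bsub>A\<^esub>" "\<zero>\<^bsub>A\<^esub>" c] pure_tensor_add_right[of a "\<zero>\<^bsub>C\<^esub>" "\<zero>\<^bsub>C\<^esub>"] assms
  by (simp_all add: pure_tensor_closed)

lemma pure_tensor_a_inv:
  assumes "a \<in> carrier A" "c \<in> carrier C"
  shows "\<ominus>\<^bsub>T\<^esub> pt a c = pt (\<ominus>\<^bsub>A\<^esub> a) c"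
  using pure_tensor_add_left[of "\<ominus>\<^bsub>A\<^esub> a" a c] assms
  by (intro T.minus_equality) (auto simp: A.l_neg pure_tensor_zero pure_tensor_closed)

text \<open>Sums of pure tensors exhaust the tensor product because a sign can be moved into the
  left entry (\<open>pure_tensor_a_inv\<close>). This is why no case for negatives or zero
  appears.\<close>

lemma tensor_induct [consumes 1, case_names pure add]:
  assumes "u \<in> carrier T"
    and pure: "\<And>a c. a \<in> carrier A \<Longrightarrow> c \<in> carrier C \<Longrightarrow> Q (pt a c)"
    and add: "\<And>u v. u \<in> carrier T \<Longrightarrow> v \<in> carrier T \<Longrightarrow> Q u \<Longrightarrow> Q v \<Longrightarrow> Q (u \<oplus>\<^bsub>T\<^esub> v)"
  shows "Q u"
proof -
  obtain x where "x \<in> carrier P" and u: "u = K +>\<^bsub>P\<^esub> x"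
    using assms(1) by (auto simp: carrier_tensor_ring)
  interpret h: ring_hom_cring P T "(+>\<^bsub>P\<^esub>) K"
    by unfold_locales (rule coset_hom)
  have inv: "K +>\<^bsub>P\<^esub> (- y) = \<ominus>\<^bsub>T\<^esub> (K +>\<^bsub>P\<^esub> y)" if "y \<in> carrier P" for y
    using h.hom_a_inv[OF that] pair_a_inv[OF that] by simp
  have Q0: "Q (\<zero>\<^bsub>T\<^esub>)"
    using pure[of "\<zero>\<^bsub>A\<^esub>" "\<zero>\<^bsub>C\<^esub>"] pure_tensor_zero(1)[of "\<zero>\<^bsub>A\<^esub>" "\<zero>\<^bsub>C\<^esub>"] by simp
  \<comment> \<open>The step of \<open>pair_induct\<close> is a difference while \<open>add\<close>
    handles only sums, so both signs are carried. Membership is carried too, because that step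
    supplies no carrier facts.\<close>
  have "x \<in> carrier P \<and> Q (K +>\<^bsub>P\<^esub> x) \<and> Q (K +>\<^bsub>P\<^esub> (- x))"
    using \<open>x \<in> carrier P\<close>
  proof (induction x rule: pair_induct)
    case zero
    then show ?case using h.hom_zero Q0 P.zero_closed by (simp add: pair_ring_simps(2))
  next
    case (frag_of a c)
    then show ?case
      using pure[of a c] pure[of "\<ominus>\<^bsub>A\<^esub> a" c] pure_tensor_a_inv[of a c]
      by (simp add: inv frag_of_closed pure_tensor_def)
  next
    case (diff x y)
    then have "Q ((K +>\<^bsub>P\<^esub> x) \<oplus>\<^bsub>T\<^esub> (K +>\<^bsub>P\<^esub> (- y)))" "Q ((K +>\<^bsub>P\<^esub> (- x)) \<oplus>\<^bsub>T\<^esub> (K +>\<^bsub>P\<^esub> y))"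
      by (auto intro!: add h.hom_closed pair_minus_closed)
    with diff show ?case
      by (simp add: coset_add[symmetric] pair_minus_closed pair_diff_closed)
  qed
  then show ?thesis by (simp add: u)
qed

end

section \<open>Maps out of a tensor product\<close>

text \<open>The hypotheses of the universal property, under which \<open>tensor_lift\<close> has a
  determined value on every coset. The target is just an abelian group; its multiplication enters
  only in \<open>tensor_lift_ring_hom\<close>.\<close>

locale tensor_map = tensor A C B f g + D: abelian_group D
  for A :: "('a, 'm) ring_scheme" and C :: "('c, 'n) ring_scheme"
    and B :: "('b, 'k) ring_scheme" and f g and D :: "('d, 'l) ring_scheme" +
  fixes h :: "'a \<Rightarrow> 'c \<Rightarrow> 'd"
  assumes h_closed: "\<lbrakk>a \<in> carrier A; c \<in> carrier C\<rbrakk> \<Longrightarrow> h a c \<in> carrier D"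
    and h_add_left: "\<lbrakk>a \<in> carrier A; a' \<in> carrier A; c \<in> carrier C\<rbrakk> \<Longrightarrow>
      h (a \<oplus>\<^bsub>A\<^esub> a') c = h a c \<oplus>\<^bsub>D\<^esub> h a' c"
    and h_add_right: "\<lbrakk>a \<in> carrier A; c \<in> carrier C; c' \<in> carrier C\<rbrakk> \<Longrightarrow>
      h a (c \<oplus>\<^bsub>C\<^esub> c') = h a c \<oplus>\<^bsub>D\<^esub> h a c'"
    and h_balanced: "\<lbrakk>a \<in> carrier A; b \<in> carrier B; c \<in> carrier C\<rbrakk> \<Longrightarrow>
      h (a \<otimes>\<^bsub>A\<^esub> f b) c = h a (g b \<otimes>\<^bsub>C\<^esub> c)"
begin

text \<open>Cancellation can make the keys of \<open>x + y\<close> smaller than the union of the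
  keys. Summing over a common finite set, where extra terms have coefficient 0, makes the three
  evaluations in \<open>pair_eval_add\<close> comparable.\<close>

lemma pair_eval_superset:
  assumes "finite F" "Poly_Mapping.keys x \<subseteq> F" "F \<subseteq> carrier A \<times> carrier C"
  shows "pair_eval D h x =
    (\<Oplus>\<^bsub>D\<^esub>p\<in>F. add_pow D (Poly_Mapping.lookup x p) (h (fst p) (snd p)))"
  unfolding pair_eval_def
proof (rule D.add.finprod_mono_neutral_cong_left[OF assms(1,2)])
  show "add_pow D (Poly_Mapping.lookup x p) (h (fst p) (snd p)) = \<zero>\<^bsub>D\<^esub>"
    if "p \<in> F - Poly_Mapping.keys x" for p
  proof -
    have "Poly_Mapping.lookup x p = 0" using that by (simp add: in_keys_iff)
    then show ?thesis by (simp add: add_pow_def)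
  qed
qed (use assms(3) in \<open>auto intro!: D.add.int_pow_closed h_closed\<close>)

lemma pair_eval_closed: "x \<in> carrier P \<Longrightarrow> pair_eval D h x \<in> carrier D"
  unfolding pair_eval_def
  by (rule D.finsum_closed) (auto simp: pair_ring_simps intro!: D.add.int_pow_closed h_closed)

lemma pair_eval_frag_of:
  "a \<in> carrier A \<Longrightarrow> c \<in> carrier C \<Longrightarrow> pair_eval D h (frag_of (a, c)) = h a c"
  by (simp add: pair_eval_def keys_frag_of h_closed D.add.int_pow_1)

lemma pair_eval_add:
  assumes "x \<in> carrier P" "y \<in> carrier P"
  shows "pair_eval D h (x + y) = pair_eval D h x \<oplus>\<^bsub>D\<^esub> pair_eval D h y"
proof -
  define F where "F = Poly_Mapping.keys x \<union> Poly_Mapping.keys y"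
  have F: "finite F" "F \<subseteq> carrier A \<times> carrier C"
    using assms by (auto simp: F_def pair_ring_simps)
  have keys: "Poly_Mapping.keys x \<subseteq> F" "Poly_Mapping.keys y \<subseteq> F" "Poly_Mapping.keys (x + y) \<subseteq> F"
    using Poly_Mapping.keys_add[of x y] by (auto simp: F_def)
  have h: "h (fst p) (snd p) \<in> carrier D" if "p \<in> F" for p
    using that F(2) by (auto intro!: h_closed)
  let ?f = "\<lambda>x p. add_pow D (Poly_Mapping.lookup x p) (h (fst p) (snd p))"
  have "(\<Oplus>\<^bsub>D\<^esub>p\<in>F. ?f (x + y) p) = (\<Oplus>\<^bsub>D\<^esub>p\<in>F. ?f x p \<oplus>\<^bsub>D\<^esub> ?f y p)"
    using h by (intro D.finsum_cong') (simp_all add: Pi_iff lookup_add D.add.int_pow_mult D.add.int_pow_closed)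
  also have "\<dots> = (\<Oplus>\<^bsub>D\<^esub>p\<in>F. ?f x p) \<oplus>\<^bsub>D\<^esub> (\<Oplus>\<^bsub>D\<^esub>p\<in>F. ?f y p)"
    using h by (intro D.finsum_addf) (simp_all add: Pi_iff D.add.int_pow_closed)
  finally show ?thesis
    unfolding keys[THEN pair_eval_superset[OF F(1) _ F(2)]] .
qed

lemma pair_eval_zero: "pair_eval D h 0 = \<zero>\<^bsub>D\<^esub>"
  by (simp add: pair_eval_def)

lemma pair_eval_minus: "x \<in> carrier P \<Longrightarrow> pair_eval D h (- x) = \<ominus>\<^bsub>D\<^esub> pair_eval D h x"
  using pair_eval_add[of "- x" x]
  by (intro D.minus_equality[symmetric])
    (simp_all add: pair_minus_closed pair_eval_closed pair_eval_zero)

lemma pair_eval_diff: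
  "x \<in> carrier P \<Longrightarrow> y \<in> carrier P \<Longrightarrow>
    pair_eval D h (x - y) = pair_eval D h x \<ominus>\<^bsub>D\<^esub> pair_eval D h y"
  using pair_eval_add[of x "- y"]
  by (simp add: pair_minus_closed pair_eval_minus D.minus_eq)

lemma pair_eval_relation:
  assumes "x \<in> tensor_relations B A f C g"
  shows "pair_eval D h x = \<zero>\<^bsub>D\<^esub>"
  using assms
proof (cases x rule: tensor_relations_cases)
  case (left a a' c)
  then show ?thesis
    by (simp add: pair_eval_diff pair_eval_frag_of pair_diff_closed frag_of_closed h_add_left
        h_closed D.minus_eq D.a_ac D.r_neg D.r_neg1 D.minus_add)
next
  case (right a c c')
  then show ?thesis
    by (simp add: pair_eval_diff pair_eval_frag_of pair_diff_closed frag_of_closed h_add_right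
        h_closed D.minus_eq D.a_ac D.r_neg D.r_neg1 D.minus_add)
next
  case (balanced a b c)
  then show ?thesis
    by (simp add: pair_eval_diff pair_eval_frag_of frag_of_closed f_closed g_closed h_balanced
        h_closed D.minus_eq D.r_neg)
qed

lemma pair_eval_kernel: "x \<in> K \<Longrightarrow> pair_eval D h x = \<zero>\<^bsub>D\<^esub>"
proof (induction x rule: kernel_induct)
  case (minus x)
  then show ?case using kernel_subset by (subst pair_eval_minus) auto
next
  case (add x y)
  then show ?case using kernel_subset by (subst pair_eval_add) auto
qed (simp_all add: pair_eval_zero pair_eval_relation)

text \<open>The evaluation is additive and vanishes on \<open>K\<close>, so its image of a coset is
  a singleton and \<open>the_elem\<close> returns the single value.\<close>

lemma tensor_lift_coset:
  assumes "x \<in> carrier P"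
  shows "tensor_lift D h (K +>\<^bsub>P\<^esub> x) = pair_eval D h x"
proof -
  have "pair_eval D h y = pair_eval D h x" if "y \<in> K +>\<^bsub>P\<^esub> x" for y
  proof -
    obtain k where "k \<in> K" "y = k + x"
      using \<open>y \<in> K +>\<^bsub>P\<^esub> x\<close> by (auto simp: a_r_coset_def' pair_ring_simps(4))
    then show ?thesis
      using assms kernel_subset by (auto simp: pair_eval_add pair_eval_kernel pair_eval_closed subset_iff)
  qed
  moreover have "x \<in> K +>\<^bsub>P\<^esub> x"
    using assms by (rule K.a_rcos_self)
  ultimately have "pair_eval D h ` (K +>\<^bsub>P\<^esub> x) = {pair_eval D h x}"
    by blast
  then show ?thesis by (simp add: tensor_lift_def)
qed

lemma tensor_lift_pure:
  "a \<in> carrier A \<Longrightarrow> c \<in> carrier C \<Longrightarrow> tensor_lift D h (pt a c) = h a c"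
  by (simp add: pure_tensor_def tensor_lift_coset frag_of_closed pair_eval_frag_of)

lemma tensor_lift_closed: "u \<in> carrier T \<Longrightarrow> tensor_lift D h u \<in> carrier D"
  by (auto simp: carrier_tensor_ring tensor_lift_coset pair_eval_closed)

lemma tensor_lift_add:
  "u \<in> carrier T \<Longrightarrow> v \<in> carrier T \<Longrightarrow>
    tensor_lift D h (u \<oplus>\<^bsub>T\<^esub> v) = tensor_lift D h u \<oplus>\<^bsub>D\<^esub> tensor_lift D h v"
  by (auto simp: carrier_tensor_ring tensor_lift_coset pair_eval_add pair_add_closed
      simp flip: coset_add)

text \<open>Both sides of the product law are biadditive, so a double \<open>tensor_induct\<close>
  reduces it to pure tensors, where it is \<open>mult\<close>.\<close>

lemma tensor_lift_ring_hom:
  assumes "ring D" and one: "h \<one>\<^bsub>A\<^esub> \<one>\<^bsub>C\<^esub> = \<one>\<^bsub>D\<^esub>"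
    and mult: "\<And>a a' c c'. \<lbrakk>a \<in> carrier A; a' \<in> carrier A; c \<in> carrier C; c' \<in> carrier C\<rbrakk> \<Longrightarrow>
      h (a \<otimes>\<^bsub>A\<^esub> a') (c \<otimes>\<^bsub>C\<^esub> c') = h a c \<otimes>\<^bsub>D\<^esub> h a' c'"
  shows "tensor_lift D h \<in> ring_hom T D"
proof (rule ring_hom_memI)
  interpret D': ring D by fact
  show "tensor_lift D h (u \<otimes>\<^bsub>T\<^esub> v) = tensor_lift D h u \<otimes>\<^bsub>D\<^esub> tensor_lift D h v"
    if "u \<in> carrier T" "v \<in> carrier T" for u v
    using that(1)
  proof (induction u rule: tensor_induct)
    case (pure a c)
    show ?case using that(2)
    proof (induction v rule: tensor_induct)
      case (pure a' c')
      then show ?case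
        using \<open>a \<in> carrier A\<close> \<open>c \<in> carrier C\<close>
        by (simp add: pure_tensor_mult tensor_lift_pure mult)
    next
      case (add v w)
      then show ?case
        using \<open>a \<in> carrier A\<close> \<open>c \<in> carrier C\<close>
        by (simp add: T.r_distr D'.r_distr tensor_lift_add tensor_lift_closed pure_tensor_closed)
    qed
  next
    case (add u w)
    then show ?case
      using that(2)
      by (simp add: T.l_distr D'.l_distr tensor_lift_add tensor_lift_closed)
  qed
  show "tensor_lift D h \<one>\<^bsub>T\<^esub> = \<one>\<^bsub>D\<^esub>"
    using tensor_lift_pure[of "\<one>\<^bsub>A\<^esub>" "\<one>\<^bsub>C\<^esub>"] one by (simp add: pure_tensor_one)
qed (simp_all add: tensor_lift_closed tensor_lift_add)

end

section \<open>The algebras of the proposition\<close>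

locale char2_algebra = R: cring R + S: cring S
  for R :: "('r, 'm) ring_scheme" and S :: "('s, 'n) ring_scheme" +
  fixes \<phi> :: "'r \<Rightarrow> 's"
  assumes \<phi>_hom: "\<phi> \<in> ring_hom R S"
    and two_zero: "\<one>\<^bsub>S\<^esub> \<oplus>\<^bsub>S\<^esub> \<one>\<^bsub>S\<^esub> = \<zero>\<^bsub>S\<^esub>"
begin

lemma \<phi>_closed: "r \<in> carrier R \<Longrightarrow> \<phi> r \<in> carrier S"
  using ring_hom_closed[OF \<phi>_hom] .

lemma add_self:
  assumes "t \<in> carrier S"
  shows "t \<oplus>\<^bsub>S\<^esub> t = \<zero>\<^bsub>S\<^esub>"
  using S.r_distr[of "\<one>\<^bsub>S\<^esub>" "\<one>\<^bsub>S\<^esub>" t] assms by (simp add: two_zero)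

text \<open>The cross terms form twice \<open>s s'\<close>. This is what makes
  \<open>rel_Frob\<close> additive in its first entry.\<close>

lemma square_add:
  assumes "s \<in> carrier S" "s' \<in> carrier S"
  shows "(s \<oplus>\<^bsub>S\<^esub> s') \<otimes>\<^bsub>S\<^esub> (s \<oplus>\<^bsub>S\<^esub> s') = s \<otimes>\<^bsub>S\<^esub> s \<oplus>\<^bsub>S\<^esub> s' \<otimes>\<^bsub>S\<^esub> s'"
proof -
  have "(s \<oplus>\<^bsub>S\<^esub> s') \<otimes>\<^bsub>S\<^esub> (s \<oplus>\<^bsub>S\<^esub> s') =
      s \<otimes>\<^bsub>S\<^esub> s \<oplus>\<^bsub>S\<^esub> s' \<otimes>\<^bsub>S\<^esub> s' \<oplus>\<^bsub>S\<^esub> (s \<otimes>\<^bsub>S\<^esub> s' \<oplus>\<^bsub>S\<^esub> s \<otimes>\<^bsub>S\<^esub> s')"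
    using assms by algebra
  with assms show ?thesis by (simp add: add_self)
qed

end

text \<open>The locale \<open>tensor\<close> lists left factor, right factor, base, whereas
  \<open>tensor_ring\<close> lists the base first.\<close>

sublocale char2_algebra \<subseteq> SS: tensor S S R \<phi> \<phi>
  rewrites "tensor_ring R S \<phi> S \<phi> = SS_ring R S \<phi>"
    and "pure_tensor R S \<phi> S \<phi> = SS_pure R S \<phi>"
  by unfold_locales (simp_all add: \<phi>_closed SS_ring_def SS_pure_def)

section \<open>Multiplication on \<open>S \<otimes> S\<close> and the subring
  \<open>Delta\<close>\<close>

context char2_algebra
begin

abbreviation SS where "SS \<equiv> SS_ring R S \<phi>"
abbreviation ss where "ss \<equiv> SS_pure R S \<phi>"
abbreviation \<mu> where "\<mu> \<equiv> SS_mult S"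

lemma mult_tensor_map: "tensor_map S S R \<phi> \<phi> S (\<otimes>\<^bsub>S\<^esub>)"
  by unfold_locales
    (simp_all add: \<phi>_closed S.l_distr S.r_distr S.m_assoc)

lemmas SS_mult_pure =
  tensor_map.tensor_lift_pure[OF mult_tensor_map, folded SS_mult_def SS_pure_def]

lemma SS_mult_hom: "\<mu> \<in> ring_hom SS S"
  unfolding SS_mult_def SS_ring_def
  by (rule tensor_map.tensor_lift_ring_hom[OF mult_tensor_map])
    (simp_all add: S.ring_axioms S.m_ac)

lemma Delta_generators:
  "{ss (\<phi> r \<otimes>\<^bsub>S\<^esub> s) s | r s. r \<in> carrier R \<and> s \<in> carrier S} \<subseteq> carrier SS"
  by (auto intro!: SS.pure_tensor_closed \<phi>_closed)

lemma Delta_subgroup: "additive_subgroup (Delta R S \<phi>) SS"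
  unfolding Delta_def
  by (intro additive_subgroup.intro SS.T.add.generate_is_subgroup) (use Delta_generators in simp)

lemma Delta_pure: "r \<in> carrier R \<Longrightarrow> s \<in> carrier S \<Longrightarrow> ss (\<phi> r \<otimes>\<^bsub>S\<^esub> s) s \<in> Delta R S \<phi>"
  unfolding Delta_def by (rule generate.incl) blast

lemma Delta_diagonal: "s \<in> carrier S \<Longrightarrow> ss s s \<in> Delta R S \<phi>"
  using Delta_pure[of "\<one>\<^bsub>R\<^esub>" s] ring_hom_one[OF \<phi>_hom] by simp

lemma Delta_symmetric:
  assumes "s \<in> carrier S"
  shows "ss \<one>\<^bsub>S\<^esub> s \<oplus>\<^bsub>SS\<^esub> ss s \<one>\<^bsub>S\<^esub> \<in> Delta R S \<phi>"
proof -
  interpret \<Delta>: additive_subgroup "Delta R S \<phi>" SS by (rule Delta_subgroup)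
  let ?s1 = "s \<oplus>\<^bsub>S\<^esub> \<one>\<^bsub>S\<^esub>"
  have "ss ?s1 ?s1 = (ss s s \<oplus>\<^bsub>SS\<^esub> ss \<one>\<^bsub>S\<^esub> s) \<oplus>\<^bsub>SS\<^esub> (ss s \<one>\<^bsub>S\<^esub> \<oplus>\<^bsub>SS\<^esub> ss \<one>\<^bsub>S\<^esub> \<one>\<^bsub>S\<^esub>)"
    using assms by (simp add: SS.pure_tensor_add_left SS.pure_tensor_add_right SS.pure_tensor_closed)
  \<comment> \<open>Used with \<open>a\<close>, \<open>b\<close>, \<open>c\<close>, \<open>d\<close>
    equal to \<open>s \<otimes> s\<close>, \<open>s \<otimes> 1\<close>,
    \<open>1 \<otimes> s\<close>, \<open>1 \<otimes> 1\<close>, the four terms in the expansion of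
    the diagonal element at \<open>s + 1\<close>.\<close>
  moreover have "c \<oplus>\<^bsub>SS\<^esub> b =
      ((a \<oplus>\<^bsub>SS\<^esub> c) \<oplus>\<^bsub>SS\<^esub> (b \<oplus>\<^bsub>SS\<^esub> d)) \<oplus>\<^bsub>SS\<^esub> (\<ominus>\<^bsub>SS\<^esub> a \<oplus>\<^bsub>SS\<^esub> \<ominus>\<^bsub>SS\<^esub> d)"
    if "a \<in> carrier SS" "b \<in> carrier SS" "c \<in> carrier SS" "d \<in> carrier SS" for a b c d
    using that by algebra
  ultimately have "ss \<one>\<^bsub>S\<^esub> s \<oplus>\<^bsub>SS\<^esub> ss s \<one>\<^bsub>S\<^esub> =
      ss ?s1 ?s1 \<oplus>\<^bsub>SS\<^esub> (\<ominus>\<^bsub>SS\<^esub> ss s s \<oplus>\<^bsub>SS\<^esub> \<ominus>\<^bsub>SS\<^esub> ss \<one>\<^bsub>S\<^esub> \<one>\<^bsub>S\<^esub>)"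
    using assms by (metis SS.pure_tensor_closed S.one_closed)
  with assms show ?thesis
    by (simp add: \<Delta>.a_closed \<Delta>.a_inv_closed Delta_diagonal)
qed

lemma SS_mult_closed: "u \<in> carrier SS \<Longrightarrow> \<mu> u \<in> carrier S"
  by (rule ring_hom_closed[OF SS_mult_hom])

end

text \<open>\<open>Q_pure\<close> accepts only pure elements of \<open>S \<otimes> S\<close> in its
  left entry. Induction over \<open>Q_ring\<close> needs arbitrary ones, so the generic
  \<open>Q.pt u t\<close> is kept.\<close>

sublocale char2_algebra \<subseteq> Q: tensor "SS_ring R S \<phi>" S "Delta_ring R S \<phi>" "\<lambda>x. x" "SS_mult S"
  rewrites "tensor_ring (Delta_ring R S \<phi>) (SS_ring R S \<phi>) (\<lambda>x. x) S (SS_mult S) = Q_ring R S \<phi>"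
  by unfold_locales
    (auto simp: Q_ring_def Delta_ring_def additive_subgroup.a_Hcarr[OF Delta_subgroup]
      intro!: SS_mult_closed)

context char2_algebra
begin

abbreviation Q where "Q \<equiv> Q_ring R S \<phi>"

lemma Q_pure_eq: "Q_pure R S \<phi> s s' t = Q.pt (ss s s') t"
  by (simp add: Q_pure_def)

text \<open>
  Since \<open>1 \<otimes> s' + s' \<otimes> 1\<close> lies in \<open>\<Delta>\<close> and is mapped to \<open>2s' = 0\<close>, multiplying it by \<open>s \<otimes> 1\<close> shows
  that \<open>s \<otimes> s'\<close> and \<open>ss' \<otimes> 1\<close> become equal in \<open>Q\<close> up to sign, and signs do not matter.
\<close>

lemma Q_pure_normal_form:
  assumes "u \<in> carrier SS" "t \<in> carrier S"
  shows "Q.pt u t = Q.pt (ss (\<mu> u) \<one>\<^bsub>S\<^esub>) t"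
  using assms(1)
proof (induction u rule: SS.tensor_induct)
  case (pure s s')
  define e where "e = ss \<one>\<^bsub>S\<^esub> s' \<oplus>\<^bsub>SS\<^esub> ss s' \<one>\<^bsub>S\<^esub>"
  note closed = pure assms(2) SS.pure_tensor_closed Q.pure_tensor_closed
  have e: "e \<in> carrier SS" "e \<in> carrier (Delta_ring R S \<phi>)"
    using closed by (simp_all add: e_def Delta_ring_def Delta_symmetric)
  have "\<mu> e = \<zero>\<^bsub>S\<^esub>"
    using closed ring_hom_add[OF SS_mult_hom] by (simp add: e_def SS_mult_pure add_self)
  then have "Q.pt (ss s \<one>\<^bsub>S\<^esub> \<otimes>\<^bsub>SS\<^esub> e) t = \<zero>\<^bsub>Q\<^esub>"
    using closed e by (simp add: Q.pure_tensor_balanced Q.pure_tensor_zero)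
  moreover have "ss s \<one>\<^bsub>S\<^esub> \<otimes>\<^bsub>SS\<^esub> e = ss s s' \<oplus>\<^bsub>SS\<^esub> ss (s \<otimes>\<^bsub>S\<^esub> s') \<one>\<^bsub>S\<^esub>"
    using closed by (simp add: e_def SS.T.r_distr SS.pure_tensor_mult)
  ultimately have "Q.pt (ss s s') t \<oplus>\<^bsub>Q\<^esub> Q.pt (ss (s \<otimes>\<^bsub>S\<^esub> s') \<one>\<^bsub>S\<^esub>) t = \<zero>\<^bsub>Q\<^esub>"
    using closed by (simp add: Q.pure_tensor_add_left)
  \<comment> \<open>The right entry lies in \<open>S\<close>, where 2 is zero, so every
    \<open>Q.pt u t\<close> is its own negative. Hence a vanishing sum of two of them is an
    equality.\<close>
  moreover have "Q.pt (ss (s \<otimes>\<^bsub>S\<^esub> s') \<one>\<^bsub>S\<^esub>) t \<oplus>\<^bsub>Q\<^esub> Q.pt (ss (s \<otimes>\<^bsub>S\<^esub> s') \<one>\<^bsub>S\<^esub>) t = \<zero>\<^bsub>Q\<^esub>"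
    using closed by (simp add: Q.pure_tensor_add_right[symmetric] add_self Q.pure_tensor_zero)
  ultimately have "Q.pt (ss s s') t = Q.pt (ss (s \<otimes>\<^bsub>S\<^esub> s') \<one>\<^bsub>S\<^esub>) t"
    using closed by (metis Q.T.minus_equality S.m_closed S.one_closed)
  then show ?case using pure by (simp add: SS_mult_pure)
next
  case (add u v)
  then show ?case
    using assms(2) ring_hom_add[OF SS_mult_hom]
    by (simp add: Q.pure_tensor_add_left SS.pure_tensor_add_left SS_mult_closed SS.pure_tensor_closed)
qed

end

section \<open>The relative Frobenius and its image in \<open>S\<close>\<close>

context char2_algebra
begin

lemma ideal2_ideal: "ideal (ideal2 R) R"
  unfolding ideal2_def by (rule R.cgenideal_ideal) simp

lemma mod2_ring_cring: "cring (mod2_ring R)"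
  unfolding mod2_ring_def by (rule ideal.quotient_is_cring[OF ideal2_ideal R.is_cring])

lemma mod2_coset_hom: "(+>\<^bsub>R\<^esub>) (ideal2 R) \<in> ring_hom R (mod2_ring R)"
  unfolding mod2_ring_def by (rule ideal.rcos_ring_hom[OF ideal2_ideal])

lemma carrier_mod2_ring: "carrier (mod2_ring R) = (+>\<^bsub>R\<^esub>) (ideal2 R) ` carrier R"
  by (auto simp: mod2_ring_def FactRing_def A_RCOSETS_def RCOSETS_def a_r_coset_def)

text \<open>Elements of the coset differ from \<open>r\<close> by a multiple of
  \<open>1 + 1\<close>, which \<open>\<phi>\<close> kills by \<open>two_zero\<close>. So the image
  of the coset is a singleton and \<open>the_elem\<close> reads off its value.\<close>

lemma mod2_map_coset:
  assumes "r \<in> carrier R"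
  shows "mod2_map \<phi> (ideal2 R +>\<^bsub>R\<^esub> r) = \<phi> r"
proof -
  interpret I: ideal "ideal2 R" R by (rule ideal2_ideal)
  have "\<phi> x = \<phi> r" if x: "x \<in> ideal2 R +>\<^bsub>R\<^esub> r" for x
  proof -
    obtain h where "h \<in> ideal2 R" and x_eq: "x = h \<oplus>\<^bsub>R\<^esub> r"
      using x unfolding a_r_coset_def' by blast
    then obtain y where y: "y \<in> carrier R" and h: "h = y \<otimes>\<^bsub>R\<^esub> (\<one>\<^bsub>R\<^esub> \<oplus>\<^bsub>R\<^esub> \<one>\<^bsub>R\<^esub>)"
      unfolding ideal2_def cgenideal_def by blast
    have "\<phi> h = \<zero>\<^bsub>S\<^esub>"
      using y by (simp add: h ring_hom_mult[OF \<phi>_hom] ring_hom_add[OF \<phi>_hom]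
          ring_hom_one[OF \<phi>_hom] \<phi>_closed two_zero del: R.r_distr)
    then show ?thesis
      using assms y by (simp add: x_eq h ring_hom_add[OF \<phi>_hom] \<phi>_closed)
  qed
  moreover have "r \<in> ideal2 R +>\<^bsub>R\<^esub> r"
    using assms by (rule I.a_rcos_self)
  ultimately have "\<phi> ` (ideal2 R +>\<^bsub>R\<^esub> r) = {\<phi> r}" by blast
  then show ?thesis by (simp add: mod2_map_def)
qed

lemma mod2_map_hom: "mod2_map \<phi> \<in> ring_hom (mod2_ring R) S"
proof (rule ring_hom_memI)
  note simps = carrier_mod2_ring mod2_map_coset \<phi>_closed
  show "mod2_map \<phi> u \<in> carrier S" if "u \<in> carrier (mod2_ring R)" for u
    using that by (auto simp: simps)
  show "mod2_map \<phi> (u \<otimes>\<^bsub>mod2_ring R\<^esub> v) = mod2_map \<phi> u \<otimes>\<^bsub>S\<^esub> mod2_map \<phi> v"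
    if "u \<in> carrier (mod2_ring R)" "v \<in> carrier (mod2_ring R)" for u v
    using that by (auto simp: simps ring_hom_mult[OF \<phi>_hom]
        simp flip: ring_hom_mult[OF mod2_coset_hom])
  show "mod2_map \<phi> (u \<oplus>\<^bsub>mod2_ring R\<^esub> v) = mod2_map \<phi> u \<oplus>\<^bsub>S\<^esub> mod2_map \<phi> v"
    if "u \<in> carrier (mod2_ring R)" "v \<in> carrier (mod2_ring R)" for u v
    using that by (auto simp: simps ring_hom_add[OF \<phi>_hom]
        simp flip: ring_hom_add[OF mod2_coset_hom])
  show "mod2_map \<phi> \<one>\<^bsub>mod2_ring R\<^esub> = \<one>\<^bsub>S\<^esub>"
    by (simp add: simps ring_hom_one[OF \<phi>_hom] flip: ring_hom_one[OF mod2_coset_hom])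
qed

lemma Frob_closed: "r \<in> carrier R \<Longrightarrow> Frob R r \<in> carrier (mod2_ring R)"
  by (simp add: Frob_def carrier_mod2_ring)

lemma mod2_map_Frob: "r \<in> carrier R \<Longrightarrow> mod2_map \<phi> (Frob R r) = \<phi> r \<otimes>\<^bsub>S\<^esub> \<phi> r"
  by (simp add: Frob_def mod2_map_coset ring_hom_mult[OF \<phi>_hom])

end

sublocale char2_algebra \<subseteq> FB: tensor S "mod2_ring R" R \<phi> "Frob R"
  rewrites "tensor_ring R S \<phi> (mod2_ring R) (Frob R) = Frob_base R S \<phi>"
proof -
  interpret M: cring "mod2_ring R" by (rule mod2_ring_cring)
  show "tensor S (mod2_ring R) R \<phi> (Frob R)"
    by unfold_locales (simp_all add: \<phi>_closed Frob_closed)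
qed (simp add: Frob_base_def)

context char2_algebra
begin

abbreviation FB where "FB \<equiv> Frob_base R S \<phi>"

lemma mod2_map_closed: "u \<in> carrier (mod2_ring R) \<Longrightarrow> mod2_map \<phi> u \<in> carrier S"
  by (rule ring_hom_closed[OF mod2_map_hom])

text \<open>Balancing is the point of the Frobenius twist: squaring \<open>s \<phi>(r)\<close>
  produces the factor \<open>\<phi>(r)\<close> twice, and \<open>Frob R r\<close> produces the same
  factor on the other side.\<close>

lemma rel_Frob_tensor_map:
  "tensor_map S (mod2_ring R) R \<phi> (Frob R) S (\<lambda>s u. s \<otimes>\<^bsub>S\<^esub> s \<otimes>\<^bsub>S\<^esub> mod2_map \<phi> u)"
proof (intro tensor_map.intro tensor_map_axioms.intro FB.tensor_axioms S.abelian_group_axioms)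
  let ?\<phi> = "mod2_map \<phi>"
  show "s \<otimes>\<^bsub>S\<^esub> s \<otimes>\<^bsub>S\<^esub> ?\<phi> u \<in> carrier S"
    if "s \<in> carrier S" "u \<in> carrier (mod2_ring R)" for s u
    using that by (simp add: mod2_map_closed)
  show "(s \<oplus>\<^bsub>S\<^esub> s') \<otimes>\<^bsub>S\<^esub> (s \<oplus>\<^bsub>S\<^esub> s') \<otimes>\<^bsub>S\<^esub> ?\<phi> u =
      s \<otimes>\<^bsub>S\<^esub> s \<otimes>\<^bsub>S\<^esub> ?\<phi> u \<oplus>\<^bsub>S\<^esub> s' \<otimes>\<^bsub>S\<^esub> s' \<otimes>\<^bsub>S\<^esub> ?\<phi> u"
    if "s \<in> carrier S" "s' \<in> carrier S" "u \<in> carrier (mod2_ring R)" for s s' u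
    unfolding square_add[OF that(1,2)] using that by (simp add: S.l_distr mod2_map_closed)
  show "s \<otimes>\<^bsub>S\<^esub> s \<otimes>\<^bsub>S\<^esub> ?\<phi> (u \<oplus>\<^bsub>mod2_ring R\<^esub> v) =
      s \<otimes>\<^bsub>S\<^esub> s \<otimes>\<^bsub>S\<^esub> ?\<phi> u \<oplus>\<^bsub>S\<^esub> s \<otimes>\<^bsub>S\<^esub> s \<otimes>\<^bsub>S\<^esub> ?\<phi> v"
    if "s \<in> carrier S" "u \<in> carrier (mod2_ring R)" "v \<in> carrier (mod2_ring R)" for s u v
    unfolding ring_hom_add[OF mod2_map_hom that(2,3)]
    using that by (simp add: S.r_distr mod2_map_closed)
  show "(s \<otimes>\<^bsub>S\<^esub> \<phi> r) \<otimes>\<^bsub>S\<^esub> (s \<otimes>\<^bsub>S\<^esub> \<phi> r) \<otimes>\<^bsub>S\<^esub> ?\<phi> u =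
      s \<otimes>\<^bsub>S\<^esub> s \<otimes>\<^bsub>S\<^esub> ?\<phi> (Frob R r \<otimes>\<^bsub>mod2_ring R\<^esub> u)"
    if "s \<in> carrier S" "r \<in> carrier R" "u \<in> carrier (mod2_ring R)" for s r u
    unfolding ring_hom_mult[OF mod2_map_hom Frob_closed[OF that(2)] that(3)] mod2_map_Frob[OF that(2)]
    using that by (simp add: S.m_ac mod2_map_closed \<phi>_closed)
qed

lemmas rel_Frob_pure =
  tensor_map.tensor_lift_pure[OF rel_Frob_tensor_map, folded rel_Frob_def]

lemma rel_Frob_hom: "rel_Frob S \<phi> \<in> ring_hom FB S"
  unfolding rel_Frob_def Frob_base_def
  by (rule tensor_map.tensor_lift_ring_hom[OF rel_Frob_tensor_map])
    (simp_all add: S.ring_axioms mod2_map_closed S.m_ac ring_hom_mult[OF mod2_map_hom]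
      ring_hom_one[OF mod2_map_hom])

lemma rel_Frob_closed: "c \<in> carrier FB \<Longrightarrow> rel_Frob S \<phi> c \<in> carrier S"
  by (rule ring_hom_closed[OF rel_Frob_hom])

text \<open>A pure tensor of \<open>s\<close> with the class of \<open>r\<close> is matched by
  \<open>\<phi>(r) s \<otimes> s\<close>. Only existence is asserted: \<open>s \<otimes> s\<close>
  is in general not additive in \<open>s\<close>, so this matching does not come from an additive
  map to \<open>Delta\<close>, but its values under \<open>\<mu>\<close> are additive.\<close>

lemma rel_Frob_imp_Delta:
  assumes "c \<in> carrier FB"
  shows "\<exists>d\<in>Delta R S \<phi>. \<mu> d = rel_Frob S \<phi> c"
  using assms
proof (induction c rule: FB.tensor_induct)
  case (pure s u)
  then obtain r where "r \<in> carrier R" "u = ideal2 R +>\<^bsub>R\<^esub> r"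
    by (auto simp: carrier_mod2_ring)
  moreover from this have "\<mu> (ss (\<phi> r \<otimes>\<^bsub>S\<^esub> s) s) = rel_Frob S \<phi> (FB.pt s u)"
    using pure S.m_comm[of "\<phi> r" "s \<otimes>\<^bsub>S\<^esub> s"]
    by (simp add: SS_mult_pure rel_Frob_pure mod2_map_coset \<phi>_closed S.m_assoc)
  ultimately show ?case
    using pure Delta_pure by blast
next
  case (add c c')
  interpret \<Delta>: additive_subgroup "Delta R S \<phi>" SS by (rule Delta_subgroup)
  from add obtain d d' where d: "d \<in> Delta R S \<phi>" "\<mu> d = rel_Frob S \<phi> c"
    "d' \<in> Delta R S \<phi>" "\<mu> d' = rel_Frob S \<phi> c'" by blast
  have "\<mu> (d \<oplus>\<^bsub>SS\<^esub> d') = rel_Frob S \<phi> (c \<oplus>\<^bsub>FB\<^esub> c')"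
    using d add.hyps by (simp add: ring_hom_add[OF SS_mult_hom] ring_hom_add[OF rel_Frob_hom])
  with d \<Delta>.a_closed show ?case by blast
qed

text \<open>The same matching read backwards on the generators of \<open>Delta\<close>. The image of
  \<open>rel_Frob\<close> is closed under sums and negatives, which covers the rest of the generated
  subgroup.\<close>

lemma Delta_imp_rel_Frob:
  assumes "d \<in> Delta R S \<phi>"
  shows "\<exists>c\<in>carrier FB. rel_Frob S \<phi> c = \<mu> d"
proof -
  interpret \<mu>: ring_hom_cring SS S \<mu>
    by unfold_locales (rule SS_mult_hom)
  interpret \<psi>: ring_hom_cring FB S "rel_Frob S \<phi>"
    by unfold_locales (rule rel_Frob_hom)
  let ?c = "\<lambda>s r. FB.pt s (ideal2 R +>\<^bsub>R\<^esub> r)"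
  have pure: "?c s r \<in> carrier FB" "rel_Frob S \<phi> (?c s r) = \<mu> (ss (\<phi> r \<otimes>\<^bsub>S\<^esub> s) s)"
    if "r \<in> carrier R" "s \<in> carrier S" for r s
    using that
    by (simp_all add: FB.pure_tensor_closed carrier_mod2_ring SS_mult_pure rel_Frob_pure
        mod2_map_coset \<phi>_closed S.m_ac)
  \<comment> \<open>Membership in the carrier is carried along because \<open>\<mu>\<close> is known
    to respect sums and negatives only there.\<close>
  have "d \<in> carrier SS \<and> (\<exists>c\<in>carrier FB. rel_Frob S \<phi> c = \<mu> d)"
    using assms unfolding Delta_def
  proof (induction d rule: generate.induct)
    case one
    have "rel_Frob S \<phi> \<zero>\<^bsub>FB\<^esub> = \<mu> \<zero>\<^bsub>SS\<^esub>" by simp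
    then show ?case
      using FB.T.zero_closed SS.T.zero_closed by (metis monoid.simps(2))
  next
    case (incl d)
    then show ?case using pure Delta_generators by blast
  next
    case (inv d)
    then obtain c where c: "c \<in> carrier FB" "rel_Frob S \<phi> c = \<mu> d"
      using pure by blast
    have d: "d \<in> carrier SS" using inv Delta_generators by blast
    have "rel_Frob S \<phi> (\<ominus>\<^bsub>FB\<^esub> c) = \<mu> (\<ominus>\<^bsub>SS\<^esub> d)" using c d by simp
    moreover have "inv\<^bsub>add_monoid SS\<^esub> d = \<ominus>\<^bsub>SS\<^esub> d"
      by (simp only: a_inv_def)
    ultimately show ?case
      using c(1) d by (metis SS.T.a_inv_closed FB.T.a_inv_closed)
  next
    case (eng d d')
    then obtain c c' where c: "c \<in> carrier FB" "rel_Frob S \<phi> c = \<mu> d"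
      "c' \<in> carrier FB" "rel_Frob S \<phi> c' = \<mu> d'" by blast
    have "rel_Frob S \<phi> (c \<oplus>\<^bsub>FB\<^esub> c') = \<mu> (d \<oplus>\<^bsub>SS\<^esub> d')"
      using c eng.IH by simp
    moreover have "d \<otimes>\<^bsub>add_monoid SS\<^esub> d' = d \<oplus>\<^bsub>SS\<^esub> d'"
      by simp
    ultimately show ?case
      using c(1,3) eng.IH by (metis SS.T.a_closed FB.T.a_closed)
  qed
  then show ?thesis ..
qed

end

sublocale char2_algebra \<subseteq> F: tensor S S "Frob_base R S \<phi>" "rel_Frob S \<phi>" "rel_Frob S \<phi>"
  rewrites "tensor_ring (Frob_base R S \<phi>) S (rel_Frob S \<phi>) S (rel_Frob S \<phi>) = F_ring R S \<phi>"
    and "pure_tensor (Frob_base R S \<phi>) S (rel_Frob S \<phi>) S (rel_Frob S \<phi>) = F_pure R S \<phi>"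
proof -
  show "tensor S S FB (rel_Frob S \<phi>) (rel_Frob S \<phi>)"
    by (intro tensor.intro tensor_axioms.intro SS.cring_pair_axioms rel_Frob_closed)
qed (simp_all only: F_ring_def F_pure_def)

section \<open>The two comparison maps and their composites\<close>

context char2_algebra
begin

abbreviation F where "F \<equiv> F_ring R S \<phi>"
abbreviation fp where "fp \<equiv> F_pure R S \<phi>"

lemma Q_to_F_inner_tensor_map:
  assumes "t \<in> carrier S"
  shows "tensor_map S S R \<phi> \<phi> F (\<lambda>s s'. fp t (s \<otimes>\<^bsub>S\<^esub> s'))"
proof (intro tensor_map.intro tensor_map_axioms.intro SS.tensor_axioms F.T.abelian_group_axioms)
  fix s r s' assume "s \<in> carrier S" "r \<in> carrier R" "s' \<in> carrier S"
  then show "fp t (s \<otimes>\<^bsub>S\<^esub> \<phi> r \<otimes>\<^bsub>S\<^esub> s') = fp t (s \<otimes>\<^bsub>S\<^esub> (\<phi> r \<otimes>\<^bsub>S\<^esub> s'))"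
    by (simp add: S.m_assoc \<phi>_closed)
qed (use assms in \<open>simp_all add: F.pure_tensor_closed F.pure_tensor_add_right S.l_distr S.r_distr\<close>)

text \<open>Replaces the inner of the two nested lifts by a closed formula. The conditions on the
  outer lift then follow from \<open>\<mu>\<close> being a ring homomorphism and the rules for
  \<open>fp\<close>.\<close>

lemma Q_to_F_inner:
  assumes "u \<in> carrier SS" "t \<in> carrier S"
  shows "tensor_lift F (\<lambda>s s'. fp t (s \<otimes>\<^bsub>S\<^esub> s')) u = fp t (\<mu> u)"
  using assms(1)
proof (induction u rule: SS.tensor_induct)
  case (pure s s')
  then show ?case
    using tensor_map.tensor_lift_pure[OF Q_to_F_inner_tensor_map[OF assms(2)]]
    by (simp add: SS_mult_pure SS_pure_def[symmetric])
next
  case (add u v)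
  then show ?case
    using assms(2)
      tensor_map.tensor_lift_add[OF Q_to_F_inner_tensor_map[OF assms(2)], folded SS_ring_def]
    by (simp add: F.pure_tensor_add_right SS_mult_closed ring_hom_add[OF SS_mult_hom])
qed

text \<open>Written as a value of \<open>rel_Frob\<close>, the element \<open>\<mu> d\<close> may
  cross the tensor sign of \<open>F_ring\<close>. With \<open>s\<close> replaced by
  \<open>\<mu> u\<close> this is the balancing condition for \<open>Q_to_F\<close>.\<close>

lemma F_pure_balanced_Delta:
  assumes "d \<in> Delta R S \<phi>" "s \<in> carrier S" "t \<in> carrier S"
  shows "fp t (s \<otimes>\<^bsub>S\<^esub> \<mu> d) = fp (\<mu> d \<otimes>\<^bsub>S\<^esub> t) s"
proof -
  obtain c where c: "c \<in> carrier FB" "rel_Frob S \<phi> c = \<mu> d"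
    using Delta_imp_rel_Frob[OF assms(1)] by blast
  have "\<mu> d \<in> carrier S"
    using rel_Frob_closed[OF c(1)] c(2) by simp
  then show ?thesis
    using F.pure_tensor_balanced[OF assms(3) c(1) assms(2)] assms c(2) by (simp add: S.m_comm)
qed

lemma Q_to_F_tensor_map:
  "tensor_map SS S (Delta_ring R S \<phi>) (\<lambda>x. x) \<mu> F
    (\<lambda>u t. tensor_lift F (\<lambda>s s'. fp t (s \<otimes>\<^bsub>S\<^esub> s')) u)"
proof (intro tensor_map.intro tensor_map_axioms.intro Q.tensor_axioms F.T.abelian_group_axioms)
  fix u d t assume u: "u \<in> carrier SS" "d \<in> carrier (Delta_ring R S \<phi>)" "t \<in> carrier S"
  then have d: "d \<in> Delta R S \<phi>" "d \<in> carrier SS"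
    using Q.f_closed by (simp_all add: Delta_ring_def)
  with u show "tensor_lift F (\<lambda>s s'. fp t (s \<otimes>\<^bsub>S\<^esub> s')) (u \<otimes>\<^bsub>SS\<^esub> d) =
      tensor_lift F (\<lambda>s s'. fp (\<mu> d \<otimes>\<^bsub>S\<^esub> t) (s \<otimes>\<^bsub>S\<^esub> s')) u"
    by (simp add: Q_to_F_inner SS_mult_closed ring_hom_mult[OF SS_mult_hom] F_pure_balanced_Delta)
qed (simp_all add: Q_to_F_inner SS_mult_closed F.pure_tensor_closed F.pure_tensor_add_left
      F.pure_tensor_add_right ring_hom_add[OF SS_mult_hom])

lemma Q_to_F_pt:
  assumes "u \<in> carrier SS" "t \<in> carrier S"
  shows "Q_to_F R S \<phi> (Q.pt u t) = fp t (\<mu> u)"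
  unfolding Q_to_F_def
  using tensor_map.tensor_lift_pure[OF Q_to_F_tensor_map assms] Q_to_F_inner[OF assms] by simp

lemma Q_to_F_hom: "Q_to_F R S \<phi> \<in> ring_hom Q F"
  unfolding Q_to_F_def Q_ring_def
proof (rule tensor_map.tensor_lift_ring_hom[OF Q_to_F_tensor_map])
  show "ring F" by (rule F.T.ring_axioms)
  show "tensor_lift F (\<lambda>s s'. fp \<one>\<^bsub>S\<^esub> (s \<otimes>\<^bsub>S\<^esub> s')) \<one>\<^bsub>SS\<^esub> = \<one>\<^bsub>F\<^esub>"
    by (simp add: Q_to_F_inner ring_hom_one[OF SS_mult_hom] F.pure_tensor_one)
qed (simp add: Q_to_F_inner SS_mult_closed ring_hom_mult[OF SS_mult_hom] F.pure_tensor_mult)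

lemma F_to_Q_tensor_map:
  "tensor_map S S FB (rel_Frob S \<phi>) (rel_Frob S \<phi>) Q (\<lambda>s s'. Q_pure R S \<phi> s' \<one>\<^bsub>S\<^esub> s)"
  unfolding Q_pure_eq
proof (intro tensor_map.intro tensor_map_axioms.intro F.tensor_axioms Q.T.abelian_group_axioms)
  fix s c s' assume s: "s \<in> carrier S" "c \<in> carrier FB" "s' \<in> carrier S"
  obtain d where d: "d \<in> Delta R S \<phi>" "\<mu> d = rel_Frob S \<phi> c"
    using rel_Frob_imp_Delta[OF s(2)] by blast
  have d': "d \<in> carrier (Delta_ring R S \<phi>)" "d \<in> carrier SS"
    using d(1) additive_subgroup.a_Hcarr[OF Delta_subgroup] by (simp_all add: Delta_ring_def)
  have "Q.pt (ss s' \<one>\<^bsub>S\<^esub>) (s \<otimes>\<^bsub>S\<^esub> \<mu> d) = Q.pt (ss s' \<one>\<^bsub>S\<^esub> \<otimes>\<^bsub>SS\<^esub> d) s"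
    using s d' by (simp add: Q.pure_tensor_balanced SS.pure_tensor_closed S.m_comm SS_mult_closed)
  \<comment> \<open>Multiplication by \<open>d\<close> need not keep the left entry in the form
    \<open>x \<otimes> 1\<close>. The normal form restores it, with \<open>x\<close> the value under
    \<open>\<mu>\<close>.\<close>
  also have "\<dots> = Q.pt (ss (s' \<otimes>\<^bsub>S\<^esub> \<mu> d) \<one>\<^bsub>S\<^esub>) s"
    using s d' Q_pure_normal_form[of "ss s' \<one>\<^bsub>S\<^esub> \<otimes>\<^bsub>SS\<^esub> d" s]
    by (simp add: SS.pure_tensor_closed ring_hom_mult[OF SS_mult_hom] SS_mult_pure)
  also have "s' \<otimes>\<^bsub>S\<^esub> \<mu> d = \<mu> d \<otimes>\<^bsub>S\<^esub> s'"
    using s d' by (intro S.m_comm SS_mult_closed)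
  finally show "Q.pt (ss s' \<one>\<^bsub>S\<^esub>) (s \<otimes>\<^bsub>S\<^esub> rel_Frob S \<phi> c) =
      Q.pt (ss (rel_Frob S \<phi> c \<otimes>\<^bsub>S\<^esub> s') \<one>\<^bsub>S\<^esub>) s"
    by (simp only: d(2))
qed (simp_all add: Q.pure_tensor_closed SS.pure_tensor_closed Q.pure_tensor_add_left
      Q.pure_tensor_add_right SS.pure_tensor_add_left)

lemma F_to_Q_fp:
  assumes "s \<in> carrier S" "s' \<in> carrier S"
  shows "F_to_Q R S \<phi> (fp s s') = Q.pt (ss s' \<one>\<^bsub>S\<^esub>) s"
  unfolding F_to_Q_def F_pure_def
  using tensor_map.tensor_lift_pure[OF F_to_Q_tensor_map assms] by (simp add: Q_pure_eq)

lemma F_to_Q_hom: "F_to_Q R S \<phi> \<in> ring_hom F Q"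
  unfolding F_to_Q_def F_ring_def
proof (rule tensor_map.tensor_lift_ring_hom[OF F_to_Q_tensor_map])
  show "ring Q" by (rule Q.T.ring_axioms)
  show "Q_pure R S \<phi> \<one>\<^bsub>S\<^esub> \<one>\<^bsub>S\<^esub> \<one>\<^bsub>S\<^esub> = \<one>\<^bsub>Q\<^esub>"
    by (simp add: Q_pure_eq SS.pure_tensor_one Q.pure_tensor_one)
qed (simp add: Q_pure_eq Q.pure_tensor_mult SS.pure_tensor_mult SS.pure_tensor_closed)

text \<open>On \<open>Q.pt u t\<close> the composite returns \<open>\<mu> u \<otimes> 1\<close> in
  place of \<open>u\<close>, which is exactly the replacement allowed by
  \<open>Q_pure_normal_form\<close>.\<close>

lemma F_to_Q_Q_to_F: "x \<in> carrier Q \<Longrightarrow> F_to_Q R S \<phi> (Q_to_F R S \<phi> x) = x"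
proof (induction x rule: Q.tensor_induct)
  case (pure u t)
  then show ?case
    by (simp add: Q_to_F_pt F_to_Q_fp SS_mult_closed Q_pure_normal_form[symmetric])
next
  case (add x y)
  then show ?case
    by (simp add: ring_hom_add[OF Q_to_F_hom] ring_hom_add[OF F_to_Q_hom]
        ring_hom_closed[OF Q_to_F_hom])
qed

lemma Q_to_F_F_to_Q: "y \<in> carrier F \<Longrightarrow> Q_to_F R S \<phi> (F_to_Q R S \<phi> y) = y"
proof (induction y rule: F.tensor_induct)
  case (pure s s')
  then show ?case
    by (simp add: Q_to_F_pt F_to_Q_fp SS.pure_tensor_closed SS_mult_pure)
next
  case (add x y)
  then show ?case
    by (simp add: ring_hom_add[OF Q_to_F_hom] ring_hom_add[OF F_to_Q_hom]
        ring_hom_closed[OF F_to_Q_hom])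
qed

lemma Q_to_F_iso: "Q_to_F R S \<phi> \<in> ring_iso Q F"
  unfolding ring_iso_def
  using Q_to_F_hom F_to_Q_Q_to_F Q_to_F_F_to_Q ring_hom_closed[OF Q_to_F_hom]
    ring_hom_closed[OF F_to_Q_hom]
  by (auto intro!: bij_betw_byWitness[where f' = "F_to_Q R S \<phi>"])

lemma F_to_Q_iso: "F_to_Q R S \<phi> \<in> ring_iso F Q"
  unfolding ring_iso_def
  using F_to_Q_hom F_to_Q_Q_to_F Q_to_F_F_to_Q ring_hom_closed[OF Q_to_F_hom]
    ring_hom_closed[OF F_to_Q_hom]
  by (auto intro!: bij_betw_byWitness[where f' = "Q_to_F R S \<phi>"])

section \<open>Compatibility with the augmentations to \<open>S\<close>\<close>

lemma F_aug_tensor_map: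
  "tensor_map S S FB (rel_Frob S \<phi>) (rel_Frob S \<phi>) S (\<otimes>\<^bsub>S\<^esub>)"
  by (intro tensor_map.intro tensor_map_axioms.intro F.tensor_axioms S.abelian_group_axioms)
    (simp_all add: S.l_distr S.r_distr S.m_assoc rel_Frob_closed)

lemmas F_aug_pure =
  tensor_map.tensor_lift_pure[OF F_aug_tensor_map, folded F_aug_def F_pure_def]
lemmas F_aug_add =
  tensor_map.tensor_lift_add[OF F_aug_tensor_map, folded F_aug_def F_ring_def]

lemma Q_aug_inner_tensor_map:
  assumes "t \<in> carrier S"
  shows "tensor_map S S R \<phi> \<phi> S (\<lambda>s s'. s \<otimes>\<^bsub>S\<^esub> s' \<otimes>\<^bsub>S\<^esub> t)"
  by (intro tensor_map.intro tensor_map_axioms.intro SS.tensor_axioms S.abelian_group_axioms)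
    (use assms in \<open>simp_all add: S.l_distr S.r_distr S.m_assoc \<phi>_closed\<close>)

lemma Q_aug_inner:
  assumes "u \<in> carrier SS" "t \<in> carrier S"
  shows "tensor_lift S (\<lambda>s s'. s \<otimes>\<^bsub>S\<^esub> s' \<otimes>\<^bsub>S\<^esub> t) u = \<mu> u \<otimes>\<^bsub>S\<^esub> t"
  using assms(1)
proof (induction u rule: SS.tensor_induct)
  case (pure s s')
  then show ?case
    using tensor_map.tensor_lift_pure[OF Q_aug_inner_tensor_map[OF assms(2)]]
    by (simp add: SS_mult_pure SS_pure_def[symmetric])
next
  case (add u v)
  then show ?case
    using assms(2)
      tensor_map.tensor_lift_add[OF Q_aug_inner_tensor_map[OF assms(2)], folded SS_ring_def]
    by (simp add: S.l_distr SS_mult_closed ring_hom_add[OF SS_mult_hom])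
qed

lemma Q_aug_tensor_map:
  "tensor_map SS S (Delta_ring R S \<phi>) (\<lambda>x. x) \<mu> S
    (\<lambda>u t. tensor_lift S (\<lambda>s s'. s \<otimes>\<^bsub>S\<^esub> s' \<otimes>\<^bsub>S\<^esub> t) u)"
  by (intro tensor_map.intro tensor_map_axioms.intro Q.tensor_axioms S.abelian_group_axioms)
    (simp_all add: Q_aug_inner SS_mult_closed S.l_distr S.r_distr S.m_assoc Q.f_closed Q.g_closed
      ring_hom_add[OF SS_mult_hom] ring_hom_mult[OF SS_mult_hom])

lemma Q_aug_pt:
  assumes "u \<in> carrier SS" "t \<in> carrier S"
  shows "Q_aug S (Q.pt u t) = \<mu> u \<otimes>\<^bsub>S\<^esub> t"
  unfolding Q_aug_def
  using tensor_map.tensor_lift_pure[OF Q_aug_tensor_map assms] Q_aug_inner[OF assms] by simp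

lemmas Q_aug_add =
  tensor_map.tensor_lift_add[OF Q_aug_tensor_map, folded Q_aug_def Q_ring_def]

text \<open>\<open>Q_to_F\<close> interchanges the roles of the two outer entries, so on pure
  tensors the claim is commutativity of the product of \<open>\<mu> u\<close> and
  \<open>t\<close>.\<close>

lemma F_aug_Q_to_F: "x \<in> carrier Q \<Longrightarrow> F_aug S (Q_to_F R S \<phi> x) = Q_aug S x"
proof (induction x rule: Q.tensor_induct)
  case (pure u t)
  then show ?case
    by (simp add: Q_to_F_pt F_aug_pure Q_aug_pt SS_mult_closed S.m_comm)
next
  case (add x y)
  then show ?case
    by (simp add: ring_hom_add[OF Q_to_F_hom] ring_hom_closed[OF Q_to_F_hom] F_aug_add Q_aug_add)
qed

lemma Q_aug_F_to_Q: "y \<in> carrier F \<Longrightarrow> Q_aug S (F_to_Q R S \<phi> y) = F_aug S y"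
  using F_aug_Q_to_F[OF ring_hom_closed[OF F_to_Q_hom]] by (simp add: Q_to_F_F_to_Q)

end

theorem proposition3p4:
  fixes R :: "('r, 'm) ring_scheme" and S :: "('s, 'n) ring_scheme" and \<phi> :: "'r \<Rightarrow> 's"
  assumes "cring R" and "cring S" and "\<phi> \<in> ring_hom R S"
    and "\<one>\<^bsub>S\<^esub> \<oplus>\<^bsub>S\<^esub> \<one>\<^bsub>S\<^esub> = \<zero>\<^bsub>S\<^esub>"
  shows
    "(\<forall>s\<in>carrier S. \<forall>s'\<in>carrier S. \<forall>t\<in>carrier S.
        Q_to_F R S \<phi> (Q_pure R S \<phi> s s' t) = F_pure R S \<phi> t (s \<otimes>\<^bsub>S\<^esub> s')) \<and>
     (\<forall>s\<in>carrier S. \<forall>s'\<in>carrier S.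
        F_to_Q R S \<phi> (F_pure R S \<phi> s s') = Q_pure R S \<phi> s' \<one>\<^bsub>S\<^esub> s) \<and>
     Q_to_F R S \<phi> \<in> ring_iso (Q_ring R S \<phi>) (F_ring R S \<phi>) \<and>
     F_to_Q R S \<phi> \<in> ring_iso (F_ring R S \<phi>) (Q_ring R S \<phi>) \<and>
     (\<forall>x\<in>carrier (Q_ring R S \<phi>). F_to_Q R S \<phi> (Q_to_F R S \<phi> x) = x) \<and>
     (\<forall>y\<in>carrier (F_ring R S \<phi>). Q_to_F R S \<phi> (F_to_Q R S \<phi> y) = y) \<and>
     (\<forall>x\<in>carrier (Q_ring R S \<phi>). F_aug S (Q_to_F R S \<phi> x) = Q_aug S x) \<and>
     (\<forall>y\<in>carrier (F_ring R S \<phi>). Q_aug S (F_to_Q R S \<phi> y) = F_aug S y) \<and>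
     (\<forall>s\<in>carrier S. Q_to_F R S \<phi> (Q_unit R S \<phi> s) = F_unit R S \<phi> s) \<and>
     (\<forall>s\<in>carrier S. F_to_Q R S \<phi> (F_unit R S \<phi> s) = Q_unit R S \<phi> s)"
proof -
  interpret char2_algebra R S \<phi>
    using assms by (intro char2_algebra.intro char2_algebra_axioms.intro)
  show ?thesis
  proof (intro conjI ballI)
    fix s s' t assume s: "s \<in> carrier S" "s' \<in> carrier S" "t \<in> carrier S"
    then show "Q_to_F R S \<phi> (Q_pure R S \<phi> s s' t) = F_pure R S \<phi> t (s \<otimes>\<^bsub>S\<^esub> s')"
      by (simp add: Q_pure_eq Q_to_F_pt SS.pure_tensor_closed SS_mult_pure)
  next
    fix s s' assume "s \<in> carrier S" "s' \<in> carrier S"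
    then show "F_to_Q R S \<phi> (F_pure R S \<phi> s s') = Q_pure R S \<phi> s' \<one>\<^bsub>S\<^esub> s"
      by (simp add: Q_pure_eq F_to_Q_fp)
  next
    fix s assume s: "s \<in> carrier S"
    then show "Q_to_F R S \<phi> (Q_unit R S \<phi> s) = F_unit R S \<phi> s"
      by (simp add: Q_unit_def F_unit_def Q_pure_eq Q_to_F_pt SS.pure_tensor_closed SS_mult_pure)
    from s show "F_to_Q R S \<phi> (F_unit R S \<phi> s) = Q_unit R S \<phi> s"
      by (simp add: Q_unit_def F_unit_def Q_pure_eq F_to_Q_fp)
  qed (simp_all add: Q_to_F_iso F_to_Q_iso F_to_Q_Q_to_F Q_to_F_F_to_Q F_aug_Q_to_F Q_aug_F_to_Q)
qed

end
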